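(* Let $d\ge2$. Assume that the distribution of $R_1$ has a probability density $p$ on $(0,\infty)$ with $p(z)\approx z^{\alpha-1}$ for $z\to0$, where $\alpha>0$, and set $\bar\alpha:=\min\{\alpha,1\}$. Furthermore, assume that $p$ is bounded. Then for any norm on $\mathbb{R}^d$ (used to define the balls), as $n\to\infty$, $$\exp\Big(-\Big(1+\frac{\alpha}{d}\Big)n\log n\cdot(1+o(1))\Big)\le\mathbb{P}[K\ge n]\le\exp\Big(-\Big(1+\frac{\bar\alpha}{d}\Big)n\log n\cdot(1+o(1))\Big).$$ Additionally, if balls are taken with respect to the $\ell_1$-norm, $$\exp\Big(-\Big(1+\frac1{d-1}\Big)n\log n\cdot(1+o(1))\Big)\le\mathbb{P}[K\ge n],$$ and if balls are taken with respect to the $\ell_2$-norm, $$\exp\Big(-\Big(1+\frac2{d-1}\Big)n\log n\cdot(1+o(1))\Big)\le\mathbb{P}[K\ge n].$$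
   Context: Setting: fix a norm $\|\cdot\|$ on $\mathbb{R}^d$ and let $B(x,r)$ be the closed ball of centre $x$ and radius $r$ in this norm. Let $(\xi_i)_{i\ge1}$ be i.i.d. uniform on $[0,1]^d$, $(R_i)_{i\ge1}$ i.i.d. positive random variables, $N$ a Poisson random variable with parameter $\lambda>0$; the families $(\xi_i)$, $(R_i)$ and $N$ are independent. Define the random set $S:=\bigcup_{i=1}^N B(\xi_i,R_i)\cap[0,1]^d$ and $$K:=\min\Big\{r\ge1 \;\Big|\; \exists\, i_1,\dots,i_r\in\{1,\dots,N\}:\ S=\bigcup_{s=1}^r B(\xi_{i_s},R_{i_s})\cap[0,1]^d\Big\},$$ with $K:=0$ if $N=0$. Notation: $p(z)\approx q(z)$ as $z\to0$ means that $p(z)/q(z)$ is bounded away from zero and infinity for all sufficiently small $z>0$. A relation $f(n)=\exp(-a\,n\log n\cdot(1+o(1)))$ (resp. $\le$, $\ge$) means there is a sequence $\varepsilon_n\to0$ with $f(n)=\exp(-a\,n\log n\,(1+\varepsilon_n))$ (resp. $\le$, $\ge$) for all large $n$. *)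

theory Defs
  imports "HOL-Probability.Probability"
begin

definition is_norm :: "(real ^ 'd \<Rightarrow> real) \<Rightarrow> bool" where
  "is_norm \<nu> \<longleftrightarrow>
     (\<forall>x. 0 \<le> \<nu> x) \<and> (\<forall>x. \<nu> x = 0 \<longleftrightarrow> x = 0) \<and>
     (\<forall>c x. \<nu> (c *\<^sub>R x) = \<bar>c\<bar> * \<nu> x) \<and> (\<forall>x y. \<nu> (x + y) \<le> \<nu> x + \<nu> y)"

definition l1_norm :: "real ^ 'd \<Rightarrow> real" where
  "l1_norm x = (\<Sum>i\<in>UNIV. \<bar>x $ i\<bar>)"

definition nball :: "(real ^ 'd \<Rightarrow> real) \<Rightarrow> real ^ 'd \<Rightarrow> real \<Rightarrow> (real ^ 'd) set" where
  "nball \<nu> x r = {y. \<nu> (y - x) \<le> r}"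

abbreviation unit_cube :: "(real ^ 'd) set" where
  "unit_cube \<equiv> cbox 0 1"

(* Independence of a combined family whose members take values in three different types cannot be
   written with indep_vars; it is stated as independence of the generated sigma-algebras. The index
   set is the disjoint sum of the index sets of the xi's, of the R's and of the single variable N.
   Only the indices i >= 1 of xi and R are used. *)
locale random_balls = prob_space M
  for M :: "'w measure"
    and \<xi> :: "nat \<Rightarrow> 'w \<Rightarrow> real ^ 'd"
    and R :: "nat \<Rightarrow> 'w \<Rightarrow> real"
    and N :: "'w \<Rightarrow> nat"
    and rate :: real +
  assumes rate_pos: "0 < rate"
    and rv_centre: "\<And>i. 1 \<le> i \<Longrightarrow> random_variable borel (\<xi> i)"
    and rv_radius: "\<And>i. 1 \<le> i \<Longrightarrow> random_variable borel (R i)"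
    and rv_number: "random_variable (count_space UNIV) N"
    and centre_uniform:
      "\<And>i. 1 \<le> i \<Longrightarrow> distr M borel (\<xi> i) = uniform_measure lborel unit_cube"
    and radius_ident: "\<And>i. 1 \<le> i \<Longrightarrow> distr M borel (R i) = distr M borel (R 1)"
    and radius_pos: "\<And>i. 1 \<le> i \<Longrightarrow> AE \<omega> in M. 0 < R i \<omega>"
    and number_poisson: "distr M (count_space UNIV) N = measure_pmf (poisson_pmf rate)"
    and independent:
      "indep_sets
        (\<lambda>j. case j of
            Inl i \<Rightarrow> sets (vimage_algebra (space M) (\<xi> i) borel)
          | Inr (Inl i) \<Rightarrow> sets (vimage_algebra (space M) (R i) borel)
          | Inr (Inr u) \<Rightarrow> sets (vimage_algebra (space M) N (count_space UNIV)))
        ({1..} <+> {1..} <+> {()})"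

definition covered_set ::
  "(real ^ 'd \<Rightarrow> real) \<Rightarrow> (nat \<Rightarrow> 'w \<Rightarrow> real ^ 'd) \<Rightarrow> (nat \<Rightarrow> 'w \<Rightarrow> real) \<Rightarrow> ('w \<Rightarrow> nat)
    \<Rightarrow> 'w \<Rightarrow> (real ^ 'd) set" where
  "covered_set \<nu> \<xi> R N \<omega> = (\<Union>i\<in>{1..N \<omega>}. nball \<nu> (\<xi> i \<omega>) (R i \<omega>) \<inter> unit_cube)"

definition cover_number ::
  "(real ^ 'd \<Rightarrow> real) \<Rightarrow> (nat \<Rightarrow> 'w \<Rightarrow> real ^ 'd) \<Rightarrow> (nat \<Rightarrow> 'w \<Rightarrow> real) \<Rightarrow> ('w \<Rightarrow> nat)
    \<Rightarrow> 'w \<Rightarrow> nat" where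
  "cover_number \<nu> \<xi> R N \<omega> =
     (if N \<omega> = 0 then 0
      else LEAST r. 1 \<le> r \<and>
        (\<exists>i :: nat \<Rightarrow> nat. (\<forall>s\<in>{1..r}. i s \<in> {1..N \<omega>}) \<and>
           covered_set \<nu> \<xi> R N \<omega> =
             (\<Union>s\<in>{1..r}. nball \<nu> (\<xi> (i s) \<omega>) (R (i s) \<omega>) \<inter> unit_cube)))"

definition comparable_at_0 :: "(real \<Rightarrow> real) \<Rightarrow> (real \<Rightarrow> real) \<Rightarrow> bool" where
  "comparable_at_0 p q \<longleftrightarrow>
     (\<exists>c C. 0 < c \<and> (\<forall>\<^sub>F z in at_right 0. c \<le> p z / q z \<and> p z / q z \<le> C))"

(* The relations f(n) <= exp(-a n log n (1 + o(1))) and f(n) >= exp(-a n log n (1 + o(1))). *)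
definition le_exp_nlogn :: "(nat \<Rightarrow> real) \<Rightarrow> real \<Rightarrow> bool" where
  "le_exp_nlogn f a \<longleftrightarrow>
     (\<exists>\<epsilon> :: nat \<Rightarrow> real. \<epsilon> \<longlonglongrightarrow> 0 \<and>
        (\<forall>\<^sub>F n in sequentially. f n \<le> exp (- a * real n * ln (real n) * (1 + \<epsilon> n))))"

definition ge_exp_nlogn :: "(nat \<Rightarrow> real) \<Rightarrow> real \<Rightarrow> bool" where
  "ge_exp_nlogn f a \<longleftrightarrow>
     (\<exists>\<epsilon> :: nat \<Rightarrow> real. \<epsilon> \<longlonglongrightarrow> 0 \<and>
        (\<forall>\<^sub>F n in sequentially. f n \<ge> exp (- a * real n * ln (real n) * (1 + \<epsilon> n))))"

end

theory Submission
  imports Defs "HOL-Real_Asymp.Real_Asymp"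
begin

text \<open>Write \<open>d\<close> for the dimension and \<open>K\<close> for the cover number. As \<open>K\<close> is at most \<open>N\<close>, a factor
  \<open>exp (- n * ln n)\<close> is the price of \<open>n\<close> balls. The other factor is the price for \<open>n\<close> balls of
  which none can be left out.

  Upper bound. In a subfamily of least cardinality no ball contains another one, so the radii of
  any two balls differ by at most the distance of their centres
  (\<open>cover_number_imp_radii_close\<close>). Cut the cube into about \<open>n / ln n\<close> cells of side length
  \<open>n powr (- 1 / d + o(1))\<close>. All but \<open>o(n)\<close> of the \<open>n\<close> centres share their cell with a centre of
  smaller index, and each of their radii is then confined to an interval of the order of the side
  length. Its probability is of the same order because the density is bounded, and independence
  gives the factor \<open>exp (- n * ln n / d)\<close> (\<open>prob_radii_close_le\<close>,
  \<open>prob_le_cover_number_le\<close>). A bounded density can only be comparable to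
  \<open>z powr (\<alpha> - 1)\<close> at 0 if \<open>\<alpha> \<ge> 1\<close>, hence \<open>1 / d\<close> is the number \<open>min \<alpha> 1 / d\<close> of the theorem
  (\<open>exponent_ge_1_if_bounded\<close>).

  Lower bounds. All three come from configurations in which each ball has a point that lies in no
  other ball (\<open>prob_le_cover_number_ge\<close>).
  \<^item> For an arbitrary norm, the points are the centres: they lie in different cells of a
    grid of side length \<open>n powr (- 1 / d)\<close> and the radii are of the order of the side length.
    Each radius costs \<open>n powr (- \<alpha> / d)\<close>.
  \<^item> For the two special norms, the points are the tips \<open>x + r * e\<close> with a fixed unit vector \<open>e\<close>.
    The tips have almost the same height in direction \<open>e\<close>, and the other coordinates of the centres
    lie in different cells of a grid of side length \<open>\<epsilon> = n powr (- 1 / (d - 1))\<close>. Then no tip is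
    in another ball as soon as the heights agree up to a constant times \<open>\<epsilon>\<close> for the cross-polytope,
    which has a corner there, and up to a constant times \<open>\<epsilon>\<^sup>2\<close> for the Euclidean ball, which is
    flat to first order there. The height is the sum of a coordinate of the centre and the radius,
    so a ball pays for this agreement only once
    (\<open>prob_le_cover_number_ge_tips\<close>, \<open>l1_norm_tip_outside\<close>, \<open>norm_tip_outside\<close>).\<close>

section \<open>Norms on Euclidean space\<close>

lemma is_norm_neg:
  assumes "is_norm \<nu>"
  shows "\<nu> (- x) = \<nu> x"
proof -
  have "\<nu> ((-1) *\<^sub>R x) = \<bar>-1\<bar> * \<nu> x"
    using assms unfolding is_norm_def by blast
  then show ?thesis by simp
qed

lemma is_norm_le:
  fixes \<nu> :: "real ^ 'd \<Rightarrow> real"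
  assumes "is_norm \<nu>"
  obtains C where "0 < C" "\<And>x. \<nu> x \<le> C * norm x"
proof -
  have tri: "\<And>x y. \<nu> (x + y) \<le> \<nu> x + \<nu> y" and hom: "\<And>c x. \<nu> (c *\<^sub>R x) = \<bar>c\<bar> * \<nu> x"
    and nn: "\<And>x. 0 \<le> \<nu> x" and zero: "\<nu> 0 = 0"
    using assms unfolding is_norm_def by auto
  have sum: "\<nu> (\<Sum>i\<in>S. f i) \<le> (\<Sum>i\<in>S. \<nu> (f i))" if "finite S" for S and f :: "'d \<Rightarrow> real ^ 'd"
    using that
  proof (induction S)
    case empty
    then show ?case by (simp add: zero)
  next
    case (insert a S)
    then show ?case using tri[of "f a" "sum f S"] by simp
  qed
  let ?C = "(\<Sum>i\<in>UNIV. \<nu> (axis i 1))"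
  have "\<nu> x \<le> ?C * norm x" for x
  proof -
    have "x = (\<Sum>i\<in>UNIV. (x $ i) *\<^sub>R axis i 1)"
      using basis_expansion[of x] by (simp add: scalar_mult_eq_scaleR)
    then have "\<nu> x = \<nu> (\<Sum>i\<in>UNIV. (x $ i) *\<^sub>R axis i 1)" by simp
    also have "\<dots> \<le> (\<Sum>i\<in>UNIV. \<nu> ((x $ i) *\<^sub>R axis i 1))" by (rule sum) simp
    also have "\<dots> = (\<Sum>i\<in>UNIV. \<bar>x $ i\<bar> * \<nu> (axis i 1))" by (simp add: hom)
    also have "\<dots> \<le> (\<Sum>i\<in>UNIV. norm x * \<nu> (axis i 1))"
      by (intro sum_mono mult_right_mono component_le_norm_cart nn)
    finally show ?thesis by (simp add: sum_distrib_left mult.commute)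
  qed
  moreover have "0 \<le> ?C" by (simp add: sum_nonneg nn)
  ultimately have "\<nu> x \<le> (?C + 1) * norm x" for x
    by (smt (verit) mult_right_mono norm_ge_zero)
  with \<open>0 \<le> ?C\<close> show thesis by (intro that[of "?C + 1"]) auto
qed

lemma is_norm_diff_le:
  assumes "is_norm \<nu>"
  shows "\<bar>\<nu> x - \<nu> y\<bar> \<le> \<nu> (x - y)"
proof -
  have tri: "\<And>x y. \<nu> (x + y) \<le> \<nu> x + \<nu> y" using assms unfolding is_norm_def by auto
  show ?thesis
    using tri[of "x - y" y] tri[of "y - x" x] is_norm_neg[OF assms, of "x - y"] by simp
qed

lemma continuous_on_is_norm:
  fixes \<nu> :: "real ^ 'd \<Rightarrow> real"
  assumes "is_norm \<nu>"
  shows "continuous_on A \<nu>"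
proof -
  obtain C where C: "0 < C" "\<And>x. \<nu> x \<le> C * norm x" using is_norm_le[OF assms] by blast
  have "C-lipschitz_on A \<nu>"
    unfolding lipschitz_on_def
    using C is_norm_diff_le[OF assms] by (auto simp: dist_real_def dist_norm intro: order_trans)
  then show ?thesis by (rule lipschitz_on_continuous_on)
qed

lemma is_norm_ge:
  fixes \<nu> :: "real ^ 'd \<Rightarrow> real"
  assumes "is_norm \<nu>"
  obtains c where "0 < c" "\<And>x. c * norm x \<le> \<nu> x"
proof -
  have hom: "\<And>c x. \<nu> (c *\<^sub>R x) = \<bar>c\<bar> * \<nu> x"
    and nn: "\<And>x. 0 \<le> \<nu> x" and zero: "\<And>x. \<nu> x = 0 \<longleftrightarrow> x = 0"
    using assms unfolding is_norm_def by auto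
  have "compact (sphere (0::real ^ 'd) 1)" by simp
  moreover have "sphere (0::real ^ 'd) 1 \<noteq> {}" by simp
  ultimately have "\<exists>x0\<in>sphere 0 1. \<forall>x\<in>sphere 0 1. \<nu> x0 \<le> \<nu> x"
    by (intro continuous_attains_inf continuous_on_is_norm[OF assms])
  then obtain x0 where x0: "x0 \<in> sphere 0 1" "\<And>x. x \<in> sphere 0 1 \<Longrightarrow> \<nu> x0 \<le> \<nu> x"
    by auto
  have pos: "0 < \<nu> x0"
  proof -
    have "x0 \<noteq> 0" using x0(1) by auto
    then have "\<nu> x0 \<noteq> 0" using zero by blast
    then show ?thesis using nn[of x0] by linarith
  qed
  have "\<nu> x0 * norm x \<le> \<nu> x" for x
  proof (cases "x = 0")
    case True
    then show ?thesis using nn[of x] by simp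
  next
    case False
    then have "\<nu> x0 \<le> \<nu> ((1 / norm x) *\<^sub>R x)" by (intro x0(2)) simp
    then show ?thesis using False by (simp add: hom field_simps)
  qed
  with pos show thesis by (rule that)
qed

section \<open>The cover number of a realisation\<close>

text \<open>An index family is an enumeration, with repetitions allowed, of a nonempty index set, so
  the cover number is the least cardinality of a set of indices whose balls cover everything.\<close>

lemma le_cover_number_iff:
  assumes "N \<omega> \<noteq> 0"
  shows "n \<le> cover_number \<nu> \<xi> R N \<omega> \<longleftrightarrow>
    (\<forall>J. J \<noteq> {} \<and> J \<subseteq> {1..N \<omega>} \<and>
       covered_set \<nu> \<xi> R N \<omega> = (\<Union>j\<in>J. nball \<nu> (\<xi> j \<omega>) (R j \<omega>) \<inter> unit_cube) \<longrightarrow> n \<le> card J)"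
    (is "_ = (\<forall>J. ?Q J \<longrightarrow> _)")
proof -
  define B where "B j = nball \<nu> (\<xi> j \<omega>) (R j \<omega>) \<inter> unit_cube" for j
  define S where "S = covered_set \<nu> \<xi> R N \<omega>"
  define P where "P r \<longleftrightarrow> 1 \<le> r \<and> (\<exists>i :: nat \<Rightarrow> nat. (\<forall>s\<in>{1..r}. i s \<in> {1..N \<omega>}) \<and>
           S = (\<Union>s\<in>{1..r}. B (i s)))" for r
  have K: "cover_number \<nu> \<xi> R N \<omega> = Least P"
    using assms unfolding cover_number_def P_def B_def S_def by (simp only: if_False)
  have Q: "?Q J \<longleftrightarrow> J \<noteq> {} \<and> J \<subseteq> {1..N \<omega>} \<and> S = (\<Union>j\<in>J. B j)" for J
    by (simp add: B_def S_def)
  have le: "Least P \<le> card J" if "?Q J" for J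
  proof -
    have fin: "finite J" using that finite_subset by blast
    then obtain i where i: "bij_betw i {1..card J} J"
      using ex_bij_betw_nat_finite_1 by blast
    have "P (card J)"
      unfolding P_def
    proof (intro conjI exI[of _ i])
      show "1 \<le> card J" using that fin by (simp add: Suc_le_eq card_gt_0_iff)
      show "\<forall>s\<in>{1..card J}. i s \<in> {1..N \<omega>}" using bij_betwE[OF i] that by blast
      have "(\<Union>s\<in>{1..card J}. B (i s)) = (\<Union>j\<in>i ` {1..card J}. B j)" by blast
      then show "S = (\<Union>s\<in>{1..card J}. B (i s))"
        using that unfolding Q bij_betw_imp_surj_on[OF i] by simp
    qed
    then show ?thesis by (rule Least_le)
  qed
  have ex: "\<exists>J. ?Q J \<and> card J \<le> Least P"
  proof -
    have "?Q {1..N \<omega>}" using assms unfolding Q S_def covered_set_def B_def by auto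
    have "P (N \<omega>)"
      unfolding P_def S_def covered_set_def B_def using assms by (intro conjI exI[of _ "\<lambda>s. s"]) auto
    then have "P (Least P)" by (rule LeastI)
    then obtain i where i: "1 \<le> Least P" "\<forall>s\<in>{1..Least P}. i s \<in> {1..N \<omega>}"
        "S = (\<Union>s\<in>{1..Least P}. B (i s))"
      unfolding P_def by blast
    have "?Q (i ` {1..Least P})" unfolding Q using i by auto
    moreover have "card (i ` {1..Least P}) \<le> Least P"
      using card_image_le[of "{1..Least P}" i] by simp
    ultimately have "?Q (i ` {1..Least P}) \<and> card (i ` {1..Least P}) \<le> Least P" by (rule conjI)
    then show ?thesis by (rule exI)
  qed
  show ?thesis
    unfolding K
  proof (intro iffI allI impI)
    fix J assume "n \<le> Least P" "?Q J"
    then show "n \<le> card J" using le[of J] by linarith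
  next
    assume *: "\<forall>J. ?Q J \<longrightarrow> n \<le> card J"
    from ex obtain J where J: "?Q J \<and> card J \<le> Least P" by (rule exE)
    from * have "?Q J \<longrightarrow> n \<le> card J" by (rule spec)
    then have "n \<le> card J" using conjunct1[OF J] by (rule mp)
    then show "n \<le> Least P" using conjunct2[OF J] by (rule order_trans)
  qed
qed

text \<open>In a subfamily of least cardinality no ball is contained in another one. Two balls are
  nested as soon as their radii differ by at least the distance of their centres.\<close>

lemma cover_number_imp_radii_close:
  assumes norm: "is_norm \<nu>" and n: "2 \<le> n" and K: "n \<le> cover_number \<nu> \<xi> R N \<omega>"
  obtains I where "I \<subseteq> {1..N \<omega>}" "card I = n"
    "\<And>i j. i \<in> I \<Longrightarrow> j \<in> I \<Longrightarrow> \<bar>R i \<omega> - R j \<omega>\<bar> \<le> \<nu> (\<xi> i \<omega> - \<xi> j \<omega>)"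
proof -
  define B where "B j = nball \<nu> (\<xi> j \<omega>) (R j \<omega>) \<inter> unit_cube" for j
  define S where "S = covered_set \<nu> \<xi> R N \<omega>"
  define Q where "Q J \<longleftrightarrow> J \<noteq> {} \<and> J \<subseteq> {1..N \<omega>} \<and> S = (\<Union>j\<in>J. B j)" for J
  have tri: "\<And>x y. \<nu> (x + y) \<le> \<nu> x + \<nu> y" and nn: "\<And>x. 0 \<le> \<nu> x"
    using norm unfolding is_norm_def by auto
  have N: "N \<omega> \<noteq> 0" using n K unfolding cover_number_def by (auto split: if_splits)
  then have ge: "n \<le> card J" if "Q J" for J
    using K that unfolding le_cover_number_iff[of N, OF N] Q_def B_def S_def by blast
  have "Q {1..N \<omega>}" using N unfolding Q_def S_def covered_set_def B_def by auto
  then obtain J where J: "Q J" "\<And>J'. Q J' \<Longrightarrow> card J \<le> card J'"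
    using ex_has_least_nat[of Q _ card] by blast
  have finJ: "finite J" using J(1) unfolding Q_def by (metis finite_atLeastAtMost finite_subset)
  have diff: "R j \<omega> - R i \<omega> < \<nu> (\<xi> i \<omega> - \<xi> j \<omega>)" if ij: "i \<in> J" "j \<in> J" "i \<noteq> j" for i j
  proof (rule ccontr)
    assume "\<not> ?thesis"
    then have le: "\<nu> (\<xi> i \<omega> - \<xi> j \<omega>) \<le> R j \<omega> - R i \<omega>" by simp
    have "B i \<subseteq> B j"
    proof
      fix y assume "y \<in> B i"
      then have "\<nu> (y - \<xi> i \<omega>) \<le> R i \<omega>" "y \<in> unit_cube" by (auto simp: B_def nball_def)
      moreover have "\<nu> (y - \<xi> j \<omega>) \<le> \<nu> (y - \<xi> i \<omega>) + \<nu> (\<xi> i \<omega> - \<xi> j \<omega>)"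
        using tri[of "y - \<xi> i \<omega>" "\<xi> i \<omega> - \<xi> j \<omega>"] by simp
      ultimately show "y \<in> B j" using le by (auto simp: B_def nball_def)
    qed
    then have "Q (J - {i})" using J(1) ij unfolding Q_def by blast
    then have "card J \<le> card (J - {i})" by (rule J(2))
    then show False using ij finJ by (metis card_Diff1_less linorder_not_less)
  qed
  obtain I where I: "I \<subseteq> J" "card I = n"
    using ge[OF J(1)] obtain_subset_with_card_n by metis
  show thesis
  proof (rule that)
    show "I \<subseteq> {1..N \<omega>}" using I(1) J(1) unfolding Q_def by blast
    show "card I = n" by fact
    fix i j assume "i \<in> I" "j \<in> I"
    show "\<bar>R i \<omega> - R j \<omega>\<bar> \<le> \<nu> (\<xi> i \<omega> - \<xi> j \<omega>)"
    proof (cases "i = j")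
      case True
      then show ?thesis using nn by simp
    next
      case False
      then have "R j \<omega> - R i \<omega> < \<nu> (\<xi> i \<omega> - \<xi> j \<omega>)" "R i \<omega> - R j \<omega> < \<nu> (\<xi> j \<omega> - \<xi> i \<omega>)"
        using diff I(1) \<open>i \<in> I\<close> \<open>j \<in> I\<close> by auto
      then show ?thesis using is_norm_neg[OF norm, of "\<xi> i \<omega> - \<xi> j \<omega>"] by simp
    qed
  qed
qed

text \<open>A subfamily with the same union has to contain ball \<open>i\<close>, as no other ball contains \<open>z i\<close>.\<close>

lemma private_points_imp_cover_number_ge:
  assumes n: "1 \<le> N \<omega>"
    and tip: "\<And>i. i \<in> {1..N \<omega>} \<Longrightarrow> z i \<in> unit_cube \<and> \<nu> (z i - \<xi> i \<omega>) \<le> R i \<omega>"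
    and sep: "\<And>i j. i \<in> {1..N \<omega>} \<Longrightarrow> j \<in> {1..N \<omega>} \<Longrightarrow> i \<noteq> j \<Longrightarrow> R j \<omega> < \<nu> (z i - \<xi> j \<omega>)"
  shows "N \<omega> \<le> cover_number \<nu> \<xi> R N \<omega>"
proof -
  have "N \<omega> \<le> card J"
    if J: "J \<subseteq> {1..N \<omega>}" "covered_set \<nu> \<xi> R N \<omega> = (\<Union>j\<in>J. nball \<nu> (\<xi> j \<omega>) (R j \<omega>) \<inter> unit_cube)"
    for J
  proof -
    have "i \<in> J" if i: "i \<in> {1..N \<omega>}" for i
    proof -
      have "z i \<in> covered_set \<nu> \<xi> R N \<omega>"
        using tip[OF i] i unfolding covered_set_def nball_def by auto
      then obtain j where "j \<in> J" "\<nu> (z i - \<xi> j \<omega>) \<le> R j \<omega>"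
        unfolding J(2) nball_def by auto
      then show ?thesis using sep[OF i, of j] J(1) by force
    qed
    then have "J = {1..N \<omega>}" using J(1) by blast
    then show ?thesis by simp
  qed
  then show ?thesis using n by (subst le_cover_number_iff) auto
qed

text \<open>That a ball is not covered by others is a union over the uncountably many points of the cube,
  and its measurability requires a reduction to countably many points. By compactness, an exact
  solution of finitely many closed conditions exists iff approximate solutions exist in a dense
  set.\<close>

lemma ex_in_compact_iff_approx:
  fixes K :: "(real ^ 'd) set" and f :: "'i \<Rightarrow> real ^ 'd \<Rightarrow> real"
  assumes K: "compact K" and D: "D \<subseteq> K" "K \<subseteq> closure D"
    and fin: "finite J" and cont: "\<And>j. j \<in> J \<Longrightarrow> continuous_on K (f j)"
  shows "(\<exists>x\<in>K. \<forall>j\<in>J. f j x \<le> 0) \<longleftrightarrow> (\<forall>m::nat. \<exists>x\<in>D. \<forall>j\<in>J. f j x \<le> 1 / Suc m)"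
proof
  assume "\<exists>x\<in>K. \<forall>j\<in>J. f j x \<le> 0"
  then obtain x where x: "x \<in> K" "\<And>j. j \<in> J \<Longrightarrow> f j x \<le> 0" by blast
  show "\<forall>m::nat. \<exists>x\<in>D. \<forall>j\<in>J. f j x \<le> 1 / Suc m"
  proof
    fix m :: nat
    have ev: "\<forall>\<^sub>F y in at x within K. \<forall>j\<in>J. f j y < 1 / Suc m"
    proof (rule eventually_ball_finite[OF fin], rule ballI)
      fix j assume "j \<in> J"
      then have "(f j \<longlongrightarrow> f j x) (at x within K)" using cont x(1) by (auto simp: continuous_on_def)
      moreover have "f j x < 1 / Suc m"
        using x(2)[OF \<open>j \<in> J\<close>] by (smt (verit) of_nat_0_less_iff zero_less_Suc zero_less_divide_1_iff)
      ultimately show "\<forall>\<^sub>F y in at x within K. f j y < 1 / Suc m" by (rule order_tendstoD(2))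
    qed
    then obtain e where e: "e > 0" "\<And>y. y \<in> K \<Longrightarrow> y \<noteq> x \<Longrightarrow> dist y x < e \<Longrightarrow> \<forall>j\<in>J. f j y < 1 / Suc m"
      unfolding eventually_at by blast
    obtain y where y: "y \<in> D" "dist y x < e"
      using x(1) D(2) e(1) by (meson closure_approachable subsetD)
    show "\<exists>x\<in>D. \<forall>j\<in>J. f j x \<le> 1 / Suc m"
    proof (rule bexI[OF _ y(1)], rule ballI)
      fix j assume "j \<in> J"
      show "f j y \<le> 1 / Suc m"
      proof (cases "y = x")
        case True
        have "(0::real) \<le> 1 / Suc m" by simp
        with x(2)[OF \<open>j \<in> J\<close>] show ?thesis unfolding True by (rule order_trans)
      next
        case False
        then show ?thesis using e(2)[of y] y D(1) \<open>j \<in> J\<close> by (auto intro: less_imp_le)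
      qed
    qed
  qed
next
  assume "\<forall>m::nat. \<exists>x\<in>D. \<forall>j\<in>J. f j x \<le> 1 / Suc m"
  then obtain x where x: "\<And>m. x m \<in> D" "\<And>m j. j \<in> J \<Longrightarrow> f j (x m) \<le> 1 / Suc m" by metis
  obtain l s where l: "l \<in> K" "strict_mono s" "(x \<circ> s) \<longlonglongrightarrow> l"
    using K x(1) D(1) unfolding compact_eq_seq_compact_metric seq_compact_def by (metis subsetD)
  have "f j l \<le> 0" if "j \<in> J" for j
  proof (rule LIMSEQ_le)
    show "(\<lambda>m. f j ((x \<circ> s) m)) \<longlonglongrightarrow> f j l"
      using continuous_on_tendsto_compose[OF cont[OF that] l(3) l(1)] x(1) D(1)
      by (auto simp: o_def intro: always_eventually)
    have "(\<lambda>m. 1 / real (Suc m)) \<longlonglongrightarrow> 0" by real_asymp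
    then show "(\<lambda>m. 1 / real (Suc (s m))) \<longlonglongrightarrow> 0"
      using LIMSEQ_subseq_LIMSEQ[OF _ l(2), of "\<lambda>m. 1 / real (Suc m)"] by (simp add: o_def)
    show "\<exists>N. \<forall>n\<ge>N. f j ((x \<circ> s) n) \<le> 1 / real (Suc (s n))"
      using x(2)[OF that] by auto
  qed
  with l(1) show "\<exists>x\<in>K. \<forall>j\<in>J. f j x \<le> 0" by blast
qed

lemma sets_Ex_point_of_ball_not_covered:
  fixes \<nu> :: "real ^ 'd \<Rightarrow> real"
  assumes norm: "is_norm \<nu>" and fin: "finite J" and K: "compact K"
    and X: "X \<in> borel_measurable M" "\<And>j. j \<in> J \<Longrightarrow> Y j \<in> borel_measurable M"
    and r: "r \<in> borel_measurable M" "\<And>j. j \<in> J \<Longrightarrow> s j \<in> borel_measurable M"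
  shows "{\<omega> \<in> space M. \<exists>x\<in>K. \<nu> (x - X \<omega>) \<le> r \<omega> \<and> (\<forall>j\<in>J. s j \<omega> < \<nu> (x - Y j \<omega>))} \<in> sets M"
proof -
  obtain D where D: "countable D" "D \<subseteq> K" "K \<subseteq> closure D" using separable by metis
  have \<nu>[measurable]: "\<nu> \<in> borel_measurable borel"
    by (intro borel_measurable_continuous_onI continuous_on_is_norm norm)
  note [measurable] = X r
  \<comment> \<open>The closed conditions: \<open>None\<close> stands for the ball that contains \<open>x\<close>, and each strict inequality
    is sharpened by \<open>1 / Suc k\<close>, to be followed by a union over \<open>k\<close>.\<close>
  define f where "f k \<omega> j x =
    (case j of None \<Rightarrow> \<nu> (x - X \<omega>) - r \<omega> | Some j \<Rightarrow> s j \<omega> + 1 / Suc k - \<nu> (x - Y j \<omega>))"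
    for k \<omega> x and j :: "_ option"
  let ?J = "insert None (Some ` J)"
  have cont: "continuous_on K (f k \<omega> j)" for k \<omega> j
  proof -
    have c: "continuous_on K (\<lambda>x. \<nu> (x - a))" for a
      by (rule continuous_on_compose2[OF continuous_on_is_norm[OF norm, of UNIV]])
        (auto intro!: continuous_intros)
    show ?thesis unfolding f_def by (cases j) (auto intro!: continuous_intros c)
  qed
  have "(\<exists>x\<in>K. \<nu> (x - X \<omega>) \<le> r \<omega> \<and> (\<forall>j\<in>J. s j \<omega> < \<nu> (x - Y j \<omega>))) \<longleftrightarrow>
      (\<exists>k. \<exists>x\<in>K. \<forall>j\<in>?J. f k \<omega> j x \<le> 0)" (is "?l \<longleftrightarrow> ?r") for \<omega>
  proof
    assume ?l
    then obtain x where x: "x \<in> K" "\<nu> (x - X \<omega>) \<le> r \<omega>" "\<And>j. j \<in> J \<Longrightarrow> s j \<omega> < \<nu> (x - Y j \<omega>)"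
      by blast
    have "\<forall>\<^sub>F k in sequentially. \<forall>j\<in>J. 1 / real (Suc k) < \<nu> (x - Y j \<omega>) - s j \<omega>"
    proof (rule eventually_ball_finite[OF fin], rule ballI)
      fix j assume "j \<in> J"
      have "(\<lambda>m. 1 / real (Suc m)) \<longlonglongrightarrow> 0" by real_asymp
      then show "\<forall>\<^sub>F k in sequentially. 1 / real (Suc k) < \<nu> (x - Y j \<omega>) - s j \<omega>"
        using x(3)[OF \<open>j \<in> J\<close>] by (intro order_tendstoD(2)) auto
    qed
    then obtain k where k: "\<forall>j\<in>J. 1 / real (Suc k) < \<nu> (x - Y j \<omega>) - s j \<omega>"
      using eventually_happens trivial_limit_sequentially by blast
    then have "\<forall>j\<in>?J. f k \<omega> j x \<le> 0" using x(2) unfolding f_def by force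
    then show ?r using x(1) by blast
  next
    assume ?r
    then obtain k x where x: "x \<in> K" "\<forall>j\<in>?J. f k \<omega> j x \<le> 0" by blast
    have "\<nu> (x - X \<omega>) \<le> r \<omega>" using x(2) by (auto simp: f_def)
    moreover have "s j \<omega> < \<nu> (x - Y j \<omega>)" if "j \<in> J" for j
    proof -
      have "s j \<omega> + 1 / Suc k - \<nu> (x - Y j \<omega>) \<le> 0" using x(2) that by (force simp: f_def)
      moreover have "(0::real) < 1 / Suc k" by simp
      ultimately show ?thesis by linarith
    qed
    ultimately show ?l using x(1) by blast
  qed
  also have "\<dots> \<omega> \<longleftrightarrow> (\<exists>k. \<forall>m::nat. \<exists>x\<in>D. \<forall>j\<in>?J. f k \<omega> j x \<le> 1 / Suc m)" for \<omega>
    using fin by (subst ex_in_compact_iff_approx[OF K D(2,3) _ cont]) auto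
  finally have eq: "{\<omega> \<in> space M. \<exists>x\<in>K. \<nu> (x - X \<omega>) \<le> r \<omega> \<and> (\<forall>j\<in>J. s j \<omega> < \<nu> (x - Y j \<omega>))}
    = {\<omega> \<in> space M. \<exists>k. \<forall>m::nat. \<exists>x\<in>D. \<forall>j\<in>?J. f k \<omega> j x \<le> 1 / Suc m}" by simp
  have [measurable]: "(\<lambda>\<omega>. f k \<omega> j x) \<in> borel_measurable M" if "j \<in> ?J" for k j x
    using that unfolding f_def by auto
  show ?thesis
    unfolding eq
    by (intro sets.sets_Collect_countable_Ex sets.sets_Collect_countable_All
        sets.sets_Collect_countable_Ex'[OF _ D(1)] sets.sets_Collect_finite_All) (use fin in auto)
qed

section \<open>Laws and independence\<close>

lemma measure_lborel_unit_cube: "measure lborel (unit_cube :: (real ^ 'd) set) = 1"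
  by (subst content_cbox_cart) (auto simp: interval_eq_empty_cart)

text \<open>The expected number of \<open>n\<close>-element subsets of a set of Poisson distributed cardinality.\<close>

lemma binomial_moment_poisson_sums:
  fixes r :: real
  shows "(\<lambda>m. real (m choose n) * (r ^ m / fact m * exp (- r))) sums (r ^ n / fact n)"
proof -
  let ?f = "\<lambda>m. real (m choose n) * (r ^ m / fact m * exp (- r))"
  have "(\<lambda>i. r ^ i /\<^sub>R fact i) sums exp r" by (rule exp_converges)
  then have "(\<lambda>i. r ^ n / fact n * exp (- r) * (r ^ i /\<^sub>R fact i)) sums (r ^ n / fact n * exp (- r) * exp r)"
    by (rule sums_mult)
  also have "(\<lambda>i. r ^ n / fact n * exp (- r) * (r ^ i /\<^sub>R fact i)) = (\<lambda>i. ?f (i + n))"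
    by (auto simp: binomial_fact power_add scaleR_conv_of_real field_simps)
  also have "r ^ n / fact n * exp (- r) * exp r = r ^ n / fact n"
    by (simp add: exp_minus)
  finally show ?thesis
    by (subst sums_zero_iff_shift[symmetric, of n]) (auto simp: binomial_eq_0)
qed

context random_balls
begin

lemma prob_centre:
  assumes "1 \<le> i" "A \<in> sets borel"
  shows "prob {\<omega> \<in> space M. \<xi> i \<omega> \<in> A} = measure lborel (A \<inter> unit_cube)"
proof -
  have "prob {\<omega> \<in> space M. \<xi> i \<omega> \<in> A} = measure (distr M borel (\<xi> i)) A"
    using assms rv_centre by (subst measure_distr) (auto intro!: arg_cong[of _ _ prob])
  also have "\<dots> = measure lborel (unit_cube \<inter> A) / measure lborel (unit_cube :: (real ^ 'd) set)"
  proof -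
    have "emeasure lborel (unit_cube :: (real ^ 'd) set) = ennreal 1"
      using emeasure_lborel_cbox_finite[of "0 :: real ^ 'd" 1] measure_lborel_unit_cube
      by (subst emeasure_eq_ennreal_measure) auto
    then show ?thesis
      unfolding centre_uniform[OF assms(1)] using assms(2) by (subst measure_uniform_measure) auto
  qed
  finally show ?thesis by (simp add: measure_lborel_unit_cube Int_commute)
qed

lemma prob_radius:
  assumes "1 \<le> i" "B \<in> sets borel"
  shows "prob {\<omega> \<in> space M. R i \<omega> \<in> B} = prob {\<omega> \<in> space M. R 1 \<omega> \<in> B}"
proof -
  have "prob {\<omega> \<in> space M. R j \<omega> \<in> B} = measure (distr M borel (R j)) B" if "1 \<le> j" for j
    using assms rv_radius that by (subst measure_distr) (auto intro!: arg_cong[of _ _ prob])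
  then show ?thesis using radius_ident[OF assms(1)] assms(1) by simp
qed

lemma prob_number: "prob {\<omega> \<in> space M. N \<omega> = m} = rate ^ m / fact m * exp (- rate)"
proof -
  have "prob {\<omega> \<in> space M. N \<omega> = m} = measure (distr M (count_space UNIV) N) {m}"
    using rv_number by (subst measure_distr) (auto intro!: arg_cong[of _ _ prob])
  then show ?thesis unfolding number_poisson using rate_pos by (simp add: measure_pmf_single)
qed

text \<open>Events that restrict each centre and each radius separately suffice for all four bounds:
  joint conditions on them are cut into disjoint events of this kind.\<close>

lemma sets_rectangle:
  assumes "finite I" "I \<subseteq> {1..}"
    and "\<And>i. i \<in> I \<Longrightarrow> A i \<in> sets borel" "\<And>i. i \<in> I \<Longrightarrow> B i \<in> sets borel"
  shows "{\<omega> \<in> space M. N \<omega> = m \<and> (\<forall>i\<in>I. \<xi> i \<omega> \<in> A i \<and> R i \<omega> \<in> B i)} \<in> events"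
proof -
  have [measurable]: "\<xi> i \<in> borel_measurable M" "R i \<in> borel_measurable M" if "i \<in> I" for i
    using that assms(2) rv_centre rv_radius by auto
  note [measurable] = rv_number assms(1,3,4)
  show ?thesis by measurable
qed

lemma prob_rectangle:
  assumes fin: "finite I" and I: "I \<subseteq> {1..}"
    and A: "\<And>i. i \<in> I \<Longrightarrow> A i \<in> sets borel" and B: "\<And>i. i \<in> I \<Longrightarrow> B i \<in> sets borel"
  shows "prob {\<omega> \<in> space M. N \<omega> = m \<and> (\<forall>i\<in>I. \<xi> i \<omega> \<in> A i \<and> R i \<omega> \<in> B i)} =
    prob {\<omega> \<in> space M. N \<omega> = m} *
      (\<Prod>i\<in>I. prob {\<omega> \<in> space M. \<xi> i \<omega> \<in> A i} * prob {\<omega> \<in> space M. R i \<omega> \<in> B i})"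
proof -
  define E where "E = case_sum (\<lambda>i. \<xi> i -` A i \<inter> space M)
    (case_sum (\<lambda>i. R i -` B i \<inter> space M) (\<lambda>u::unit. N -` {m} \<inter> space M))"
  let ?J = "I <+> I <+> {()}"
  have "prob (\<Inter>j\<in>?J. E j) = (\<Prod>j\<in>?J. prob (E j))"
    using fin I A B
    by (intro indep_setsD[OF independent])
      (auto simp: E_def intro!: in_vimage_algebra)
  moreover have "(\<Inter>j\<in>?J. E j) = {\<omega> \<in> space M. N \<omega> = m \<and> (\<forall>i\<in>I. \<xi> i \<omega> \<in> A i \<and> R i \<omega> \<in> B i)}"
  proof (intro set_eqI iffI)
    fix \<omega> assume \<omega>: "\<omega> \<in> (\<Inter>j\<in>?J. E j)"
    then have "\<omega> \<in> E (Inr (Inr ()))" by blast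
    moreover have "\<omega> \<in> E (Inl i)" "\<omega> \<in> E (Inr (Inl i))" if "i \<in> I" for i
      using \<omega> that by blast+
    ultimately show "\<omega> \<in> {\<omega> \<in> space M. N \<omega> = m \<and> (\<forall>i\<in>I. \<xi> i \<omega> \<in> A i \<and> R i \<omega> \<in> B i)}"
      by (auto simp: E_def)
  qed (auto simp: E_def)
  moreover have "(\<Prod>j\<in>?J. prob (E j)) = (\<Prod>i\<in>I. prob (\<xi> i -` A i \<inter> space M)) *
      ((\<Prod>i\<in>I. prob (R i -` B i \<inter> space M)) * prob (N -` {m} \<inter> space M))"
    using fin by (simp add: prod.Plus E_def)
  ultimately show ?thesis
    by (simp add: prod.distrib vimage_def Int_def conj_commute mult_ac)
qed

section \<open>Measurability of the cover number\<close>

lemma sets_le_cover_number: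
  assumes norm: "is_norm \<nu>"
  shows "{\<omega> \<in> space M. n \<le> cover_number \<nu> \<xi> R N \<omega>} \<in> events"
proof (cases "n = 0")
  case True
  then show ?thesis by simp
next
  case False
  \<comment> \<open>Among the first \<open>m\<close> balls, some ball has a point that the balls in \<open>J\<close> miss.\<close>
  define U where "U m J \<omega> \<longleftrightarrow> (\<exists>i\<in>{1..m}. \<exists>x\<in>unit_cube. \<nu> (x - \<xi> i \<omega>) \<le> R i \<omega> \<and>
    (\<forall>j\<in>J. R j \<omega> < \<nu> (x - \<xi> j \<omega>)))" for m J \<omega>
  have "n \<le> cover_number \<nu> \<xi> R N \<omega> \<longleftrightarrow>
    (\<exists>m\<in>{1..}. N \<omega> = m \<and> (\<forall>J\<in>{J. J \<noteq> {} \<and> J \<subseteq> {1..m} \<and> card J < n}. U m J \<omega>))" for \<omega>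
  proof (cases "N \<omega> = 0")
    case True
    then show ?thesis using False by (simp add: cover_number_def)
  next
    case N: False
    have at_N: "Q (N \<omega>) \<longleftrightarrow> (\<exists>m\<in>{1..}. N \<omega> = m \<and> Q m)" for Q
      using N by auto
    define C where "C J \<longleftrightarrow>
      covered_set \<nu> \<xi> R N \<omega> = (\<Union>j\<in>J. nball \<nu> (\<xi> j \<omega>) (R j \<omega>) \<inter> unit_cube)" for J
    have C: "C J \<longleftrightarrow> \<not> U (N \<omega>) J \<omega>" if "J \<subseteq> {1..N \<omega>}" for J
    proof -
      have "(\<Union>j\<in>J. nball \<nu> (\<xi> j \<omega>) (R j \<omega>) \<inter> unit_cube) \<subseteq> covered_set \<nu> \<xi> R N \<omega>"
        using that unfolding covered_set_def by blast
      moreover have "covered_set \<nu> \<xi> R N \<omega> \<subseteq> (\<Union>j\<in>J. nball \<nu> (\<xi> j \<omega>) (R j \<omega>) \<inter> unit_cube) \<longleftrightarrow>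
          \<not> U (N \<omega>) J \<omega>"
        unfolding covered_set_def U_def nball_def
        by (auto simp: subset_eq not_less simp del: mem_box)
      ultimately show ?thesis unfolding C_def by blast
    qed
    have "n \<le> cover_number \<nu> \<xi> R N \<omega> \<longleftrightarrow>
        (\<forall>J. J \<noteq> {} \<and> J \<subseteq> {1..N \<omega>} \<and> C J \<longrightarrow> \<not> card J < n)"
      unfolding le_cover_number_iff[of N, OF N] C_def linorder_not_less ..
    also have "\<dots> \<longleftrightarrow> (\<forall>J\<in>{J. J \<noteq> {} \<and> J \<subseteq> {1..N \<omega>} \<and> card J < n}. U (N \<omega>) J \<omega>)"
      (is "_ \<longleftrightarrow> ?Q (N \<omega>)")
      using C by blast
    also have "\<dots> \<longleftrightarrow> (\<exists>m\<in>{1..}. N \<omega> = m \<and> ?Q m)"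
      by (rule at_N)
    finally show ?thesis .
  qed
  moreover have "{\<omega> \<in> space M. \<exists>m\<in>{1..}. N \<omega> = m \<and>
      (\<forall>J\<in>{J. J \<noteq> {} \<and> J \<subseteq> {1..m} \<and> card J < n}. U m J \<omega>)} \<in> events"
  proof (intro sets.sets_Collect_countable_Ex' sets.sets_Collect_conj sets.sets_Collect_finite_All)
    fix m :: nat
    note [measurable] = rv_number
    show "{\<omega> \<in> space M. N \<omega> = m} \<in> events" by measurable
    show "finite {J. J \<noteq> {} \<and> J \<subseteq> {1..m} \<and> card J < n}"
      by (rule finite_subset[of _ "Pow {1..m}"]) auto
    fix J assume "J \<in> {J. J \<noteq> {} \<and> J \<subseteq> {1..m} \<and> card J < n}"
    then have J: "J \<subseteq> {1..m}" by auto
    then show "{\<omega> \<in> space M. U m J \<omega>} \<in> events"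
      unfolding U_def
      by (intro sets.sets_Collect_finite_Ex sets_Ex_point_of_ball_not_covered norm
          rv_centre rv_radius) (auto intro: finite_subset)
  qed auto
  ultimately show ?thesis by simp
qed

section \<open>Lower bound: many disjoint configurations of indispensable balls\<close>

text \<open>Given \<open>N = n\<close>, assign to the \<open>n\<close> balls different labels in \<open>G\<close> and arbitrary labels in
  \<open>J\<close>, and let centre and radius of each ball lie in the sets belonging to its two labels. As
  the point \<open>tip x r\<close> of the ball with centre \<open>x\<close> and radius \<open>r\<close> is not in the other balls, no
  ball can be left out. The events for different assignments are disjoint, there are at least
  \<open>fact n * card J ^ n\<close> of them, and the factor \<open>fact n\<close> cancels the one in the Poisson weight.\<close>

lemma prob_le_cover_number_ge:
  fixes tip :: "real ^ 'd \<Rightarrow> real \<Rightarrow> real ^ 'd"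
    and D :: "'g \<Rightarrow> 'j \<Rightarrow> (real ^ 'd) set" and T :: "'j \<Rightarrow> real set"
  assumes norm: "is_norm \<nu>" and n: "1 \<le> n"
    and G: "finite G" "n \<le> card G" and J: "finite J"
    and D: "\<And>g j. g \<in> G \<Longrightarrow> j \<in> J \<Longrightarrow> D g j \<in> sets borel"
    and T: "\<And>j. j \<in> J \<Longrightarrow> T j \<in> sets borel"
    and disj: "\<And>g j g' j'. g \<in> G \<Longrightarrow> j \<in> J \<Longrightarrow> g' \<in> G \<Longrightarrow> j' \<in> J \<Longrightarrow> (g, j) \<noteq> (g', j') \<Longrightarrow>
      D g j \<inter> D g' j' = {}"
    and u: "0 \<le> u" "\<And>g j. g \<in> G \<Longrightarrow> j \<in> J \<Longrightarrow> u \<le> prob {\<omega> \<in> space M. \<xi> 1 \<omega> \<in> D g j}"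
    and v: "0 \<le> v" "\<And>j. j \<in> J \<Longrightarrow> v \<le> prob {\<omega> \<in> space M. R 1 \<omega> \<in> T j}"
    and tip: "\<And>g j x r. g \<in> G \<Longrightarrow> j \<in> J \<Longrightarrow> x \<in> D g j \<Longrightarrow> r \<in> T j \<Longrightarrow>
      tip x r \<in> unit_cube \<and> \<nu> (tip x r - x) \<le> r"
    and sep: "\<And>g j x r g' j' x' r'. g \<in> G \<Longrightarrow> j \<in> J \<Longrightarrow> x \<in> D g j \<Longrightarrow> r \<in> T j \<Longrightarrow>
      g' \<in> G \<Longrightarrow> j' \<in> J \<Longrightarrow> x' \<in> D g' j' \<Longrightarrow> r' \<in> T j' \<Longrightarrow> g \<noteq> g' \<Longrightarrow> r' < \<nu> (tip x r - x')"
  shows "exp (- rate) * (rate * real (card J) * u * v) ^ n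
    \<le> prob {\<omega> \<in> space M. n \<le> cover_number \<nu> \<xi> R N \<omega>}"
proof -
  let ?I = "{1..n}"
  define \<Sigma> where "\<Sigma> = {\<sigma> \<in> ?I \<rightarrow>\<^sub>E G. inj_on \<sigma> ?I}"
  define \<Phi> where "\<Phi> = \<Sigma> \<times> (?I \<rightarrow>\<^sub>E J)"
  define E where "E = (\<lambda>(\<sigma>, j). {\<omega> \<in> space M. N \<omega> = n \<and>
    (\<forall>i\<in>?I. \<xi> i \<omega> \<in> D (\<sigma> i) (j i) \<and> R i \<omega> \<in> T (j i))})"
  have fin\<Sigma>: "finite \<Sigma>"
    unfolding \<Sigma>_def using G by (intro finite_subset[OF _ finite_PiE[of ?I "\<lambda>_. G"]]) auto
  have fin: "finite \<Phi>"
    unfolding \<Phi>_def using fin\<Sigma> J by (intro finite_cartesian_product finite_PiE) auto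
  have \<Phi>: "\<sigma> i \<in> G" "j i \<in> J" if "(\<sigma>, j) \<in> \<Phi>" "i \<in> ?I" for \<sigma> j i
    using that unfolding \<Phi>_def \<Sigma>_def by auto
  have card\<Sigma>: "fact n \<le> card \<Sigma>"
  proof -
    have "card \<Sigma> = (\<Prod>i\<in>{0..<n}. card G - i)"
      unfolding \<Sigma>_def using G by (subst card_inj_on_subset_funcset) auto
    also have "\<dots> \<ge> (\<Prod>i\<in>{0..<n}. n - i)" using G(2) by (intro prod_mono) auto
    finally show ?thesis by (simp add: fact_prod_rev)
  qed
  have sets: "E \<phi> \<in> events" if "\<phi> \<in> \<Phi>" for \<phi>
  proof -
    obtain \<sigma> j where \<phi>: "\<phi> = (\<sigma>, j)" by (cases \<phi>)
    show ?thesis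
      unfolding \<phi> E_def prod.case using \<Phi>[of \<sigma> j] that unfolding \<phi>
      by (intro sets_rectangle) (auto intro!: D T)
  qed
  have prob_E: "rate ^ n / fact n * exp (- rate) * (u * v) ^ n \<le> prob (E \<phi>)" if "\<phi> \<in> \<Phi>" for \<phi>
  proof -
    obtain \<sigma> j where \<phi>: "\<phi> = (\<sigma>, j)" by (cases \<phi>)
    note \<Phi> = \<Phi>[OF that[unfolded \<phi>]]
    have "(u * v) ^ n = (\<Prod>i\<in>?I. u * v)" by simp
    also have "\<dots> \<le> (\<Prod>i\<in>?I. prob {\<omega> \<in> space M. \<xi> i \<omega> \<in> D (\<sigma> i) (j i)} *
        prob {\<omega> \<in> space M. R i \<omega> \<in> T (j i)})"
    proof (rule prod_mono)
      fix i assume i: "i \<in> ?I"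
      then have "1 \<le> i" by simp
      have "prob {\<omega> \<in> space M. \<xi> i \<omega> \<in> D (\<sigma> i) (j i)} = prob {\<omega> \<in> space M. \<xi> 1 \<omega> \<in> D (\<sigma> i) (j i)}"
        using prob_centre[OF \<open>1 \<le> i\<close>] prob_centre[of 1] D \<Phi> i by simp
      moreover have "prob {\<omega> \<in> space M. R i \<omega> \<in> T (j i)} = prob {\<omega> \<in> space M. R 1 \<omega> \<in> T (j i)}"
        using prob_radius[OF \<open>1 \<le> i\<close>] T \<Phi> i by simp
      ultimately show "0 \<le> u * v \<and> u * v \<le> prob {\<omega> \<in> space M. \<xi> i \<omega> \<in> D (\<sigma> i) (j i)} *
          prob {\<omega> \<in> space M. R i \<omega> \<in> T (j i)}"
        using u v \<Phi> i by (auto intro!: mult_mono)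
    qed
    finally have "rate ^ n / fact n * exp (- rate) * (u * v) ^ n \<le>
       rate ^ n / fact n * exp (- rate) * (\<Prod>i\<in>?I. prob {\<omega> \<in> space M. \<xi> i \<omega> \<in> D (\<sigma> i) (j i)} *
        prob {\<omega> \<in> space M. R i \<omega> \<in> T (j i)})"
      using rate_pos by (intro mult_left_mono) auto
    also have "\<dots> = prob (E \<phi>)"
      unfolding \<phi> E_def prod.case using \<Phi> D T by (subst prob_rectangle) (auto simp: prob_number)
    finally show ?thesis .
  qed
  have disjoint: "disjoint_family_on E \<Phi>"
    unfolding disjoint_family_on_def
  proof (intro ballI impI)
    fix \<phi> \<phi>' assume \<phi>: "\<phi> \<in> \<Phi>" "\<phi>' \<in> \<Phi>" "\<phi> \<noteq> \<phi>'"
    obtain \<sigma> j \<sigma>' j' where eq: "\<phi> = (\<sigma>, j)" "\<phi>' = (\<sigma>', j')" by (cases \<phi>, cases \<phi>')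
    have ext: "\<sigma> \<in> extensional ?I" "\<sigma>' \<in> extensional ?I" "j \<in> extensional ?I" "j' \<in> extensional ?I"
      using \<phi>(1,2) unfolding eq \<Phi>_def \<Sigma>_def by (auto simp: PiE_def)
    obtain i where i: "i \<in> ?I" "(\<sigma> i, j i) \<noteq> (\<sigma>' i, j' i)"
      using extensionalityI[OF ext(1,2)] extensionalityI[OF ext(3,4)] \<phi>(3) unfolding eq by auto
    have "D (\<sigma> i) (j i) \<inter> D (\<sigma>' i) (j' i) = {}"
      using \<Phi> \<phi>(1,2) i unfolding eq by (intro disj) auto
    then show "E \<phi> \<inter> E \<phi>' = {}" using i(1) unfolding eq E_def prod.case by blast
  qed
  have sub: "\<Union> (E ` \<Phi>) \<subseteq> {\<omega> \<in> space M. n \<le> cover_number \<nu> \<xi> R N \<omega>}"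
  proof safe
    fix \<sigma> j \<omega> assume \<phi>: "(\<sigma>, j) \<in> \<Phi>" and "\<omega> \<in> E (\<sigma>, j)"
    then have \<omega>: "\<omega> \<in> space M" "N \<omega> = n"
      and in_DT: "\<And>i. i \<in> ?I \<Longrightarrow> \<xi> i \<omega> \<in> D (\<sigma> i) (j i)" "\<And>i. i \<in> ?I \<Longrightarrow> R i \<omega> \<in> T (j i)"
      unfolding E_def by auto
    show "\<omega> \<in> space M" by fact
    have inj: "inj_on \<sigma> ?I" using \<phi> unfolding \<Phi>_def \<Sigma>_def by auto
    have "N \<omega> \<le> cover_number \<nu> \<xi> R N \<omega>"
    proof (rule private_points_imp_cover_number_ge[where z = "\<lambda>i. tip (\<xi> i \<omega>) (R i \<omega>)"])
      show "1 \<le> N \<omega>" using \<omega> n by simp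
      show "tip (\<xi> i \<omega>) (R i \<omega>) \<in> unit_cube \<and> \<nu> (tip (\<xi> i \<omega>) (R i \<omega>) - \<xi> i \<omega>) \<le> R i \<omega>"
        if "i \<in> {1..N \<omega>}" for i
        using that in_DT \<Phi>[OF \<phi>] unfolding \<omega> by (intro tip) auto
      show "R k \<omega> < \<nu> (tip (\<xi> i \<omega>) (R i \<omega>) - \<xi> k \<omega>)"
        if "i \<in> {1..N \<omega>}" "k \<in> {1..N \<omega>}" "i \<noteq> k" for i k
      proof -
        have "\<sigma> i \<noteq> \<sigma> k" using that inj \<omega> unfolding inj_on_def by metis
        with that in_DT \<Phi>[OF \<phi>] show ?thesis
          unfolding \<omega> by (intro sep[of "\<sigma> i" "j i" _ _ "\<sigma> k" "j k"]) auto
      qed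
    qed
    then show "n \<le> cover_number \<nu> \<xi> R N \<omega>" using \<omega> by simp
  qed
  have "exp (- rate) * (rate * real (card J) * u * v) ^ n =
      fact n * real (card J) ^ n * (rate ^ n / fact n * exp (- rate) * (u * v) ^ n)"
    by (simp add: power_mult_distrib)
  also have "\<dots> \<le> real (card \<Phi>) * (rate ^ n / fact n * exp (- rate) * (u * v) ^ n)"
  proof (rule mult_right_mono)
    have "card \<Phi> = card \<Sigma> * card J ^ n" unfolding \<Phi>_def by (simp add: card_cartesian_product card_funcsetE)
    then have "real (card \<Phi>) = real (card \<Sigma>) * real (card J) ^ n" by simp
    moreover have "fact n \<le> real (card \<Sigma>)" using card\<Sigma> by (metis of_nat_fact of_nat_le_iff)
    ultimately show "fact n * real (card J) ^ n \<le> real (card \<Phi>)" by (simp add: mult_right_mono)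
    show "0 \<le> rate ^ n / fact n * exp (- rate) * (u * v) ^ n" using rate_pos u v by simp
  qed
  also have "\<dots> = (\<Sum>\<phi>\<in>\<Phi>. rate ^ n / fact n * exp (- rate) * (u * v) ^ n)" by simp
  also have "\<dots> \<le> (\<Sum>\<phi>\<in>\<Phi>. prob (E \<phi>))" by (intro sum_mono prob_E)
  also have "\<dots> = prob (\<Union> (E ` \<Phi>))"
    using sets by (intro finite_measure_finite_Union[symmetric] fin disjoint) auto
  also have "\<dots> \<le> prob {\<omega> \<in> space M. n \<le> cover_number \<nu> \<xi> R N \<omega>}"
    by (intro finite_measure_mono sub sets_le_cover_number norm)
  finally show ?thesis .
qed

end

section \<open>Upper bound: radii of balls with close centres are close\<close>

context random_balls
begin

text \<open>The first index of each cell is free, every other radius is confined to an interval of length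
  \<open>3 * \<delta>\<close> once the radius of the first index in the same cell is known up to \<open>\<delta>\<close>. The
  events that fix the cells of all centres and the rounded radii of the first indices are disjoint,
  so their probabilities can be summed without loss, and each of the remaining radii contributes a
  factor \<open>q\<close> by independence.\<close>

lemma prob_radii_close_le:
  fixes cell :: "real ^ 'd \<Rightarrow> 'c" and C :: "'c set"
  assumes I: "finite I" "I \<subseteq> {1..}" and C: "finite C"
    and cell: "\<And>c. c \<in> C \<Longrightarrow> cell -` {c} \<in> sets borel"
    and \<delta>: "0 < \<delta>" and q: "0 \<le> q" "q \<le> 1" "\<And>a. prob {\<omega> \<in> space M. R 1 \<omega> \<in> {a..a + 3 * \<delta>}} \<le> q"
  shows "prob {\<omega> \<in> space M. N \<omega> = m \<and> (\<forall>i\<in>I. cell (\<xi> i \<omega>) \<in> C) \<and>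
      (\<forall>i\<in>I. \<forall>j\<in>I. cell (\<xi> i \<omega>) = cell (\<xi> j \<omega>) \<longrightarrow> \<bar>R i \<omega> - R j \<omega>\<bar> \<le> \<delta>)}
    \<le> prob {\<omega> \<in> space M. N \<omega> = m} * q ^ (card I - card C)" (is "prob ?G \<le> _")
proof -
  define rep where "rep \<sigma> i = (LEAST j. j \<in> I \<and> \<sigma> j = \<sigma> i)" for \<sigma> :: "nat \<Rightarrow> 'c" and i
  define roots where "roots \<sigma> = rep \<sigma> ` I" for \<sigma>
  define \<Lambda> where "\<Lambda> = (SIGMA \<sigma>:I \<rightarrow>\<^sub>E C. roots \<sigma> \<rightarrow>\<^sub>E (UNIV :: int set))"
  define bin where "bin b = {x. \<lfloor>x / \<delta>\<rfloor> = b}" for b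
  \<comment> \<open>All numbers at distance at most \<open>\<delta>\<close> from the interval \<open>bin b\<close>, which has length \<open>\<delta>\<close>.\<close>
  define near where "near b = {(of_int b - 1) * \<delta>..(of_int b - 1) * \<delta> + 3 * \<delta>}" for b :: int
  define E where "E = (\<lambda>(\<sigma>, \<beta>). {\<omega> \<in> space M. N \<omega> = m \<and>
    (\<forall>i\<in>I. \<xi> i \<omega> \<in> cell -` {\<sigma> i} \<and> R i \<omega> \<in> (if i \<in> roots \<sigma> then bin (\<beta> i) else UNIV))})"
  define F where "F = (\<lambda>(\<sigma>, \<beta>). {\<omega> \<in> space M. N \<omega> = m \<and>
    (\<forall>i\<in>I. \<xi> i \<omega> \<in> cell -` {\<sigma> i} \<and> R i \<omega> \<in> (if i \<in> roots \<sigma> then bin (\<beta> i) else near (\<beta> (rep \<sigma> i))))})"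
  have rep: "rep \<sigma> i \<in> I" "\<sigma> (rep \<sigma> i) = \<sigma> i" if "i \<in> I" for \<sigma> i
    using LeastI[of "\<lambda>j. j \<in> I \<and> \<sigma> j = \<sigma> i" i] that unfolding rep_def by auto
  have roots_I: "roots \<sigma> \<subseteq> I" for \<sigma> unfolding roots_def using rep by auto
  have card_roots: "card (roots \<sigma>) \<le> card C" if "\<sigma> \<in> I \<rightarrow>\<^sub>E C" for \<sigma>
  proof (rule card_inj_on_le[OF _ _ C])
    show "inj_on \<sigma> (roots \<sigma>)"
    proof (rule inj_onI)
      fix x y assume "x \<in> roots \<sigma>" "y \<in> roots \<sigma>" and xy: "\<sigma> x = \<sigma> y"
      then obtain i j where ij: "x = rep \<sigma> i" "y = rep \<sigma> j" "i \<in> I" "j \<in> I" unfolding roots_def by auto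
      then have "\<sigma> i = \<sigma> j" using xy rep by metis
      then show "x = y" unfolding ij rep_def by simp
    qed
    show "\<sigma> ` roots \<sigma> \<subseteq> C" using that roots_I by (auto simp: PiE_def Pi_def)
  qed
  have count: "countable \<Lambda>"
  proof -
    have "countable (I \<rightarrow>\<^sub>E C)" using I(1) C by (intro countable_finite finite_PiE) auto
    moreover have "countable (roots \<sigma> \<rightarrow>\<^sub>E (UNIV :: int set))" for \<sigma>
      using finite_subset[OF roots_I I(1)] by (intro countable_PiE) auto
    ultimately show ?thesis unfolding \<Lambda>_def by (intro countable_SIGMA)
  qed
  have bin_sets: "bin b \<in> sets borel" for b
  proof -
    have "bin b = {of_int b * \<delta>..<(of_int b + 1) * \<delta>}"
      unfolding bin_def using \<delta> by (auto simp: floor_eq_iff field_simps)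
    then show ?thesis by simp
  qed
  have near_sets: "near b \<in> sets borel" for b unfolding near_def by simp
  have \<sigma>C: "\<sigma> i \<in> C" if "(\<sigma>, \<beta>) \<in> \<Lambda>" "i \<in> I" for \<sigma> \<beta> i
    using that unfolding \<Lambda>_def by auto
  have E_sets: "E l \<in> events" and F_sets: "F l \<in> events" if "l \<in> \<Lambda>" for l
  proof -
    obtain \<sigma> \<beta> where l: "l = (\<sigma>, \<beta>)" by (cases l)
    show "E l \<in> events" "F l \<in> events"
      unfolding l E_def F_def prod.case using that \<sigma>C unfolding l
      by (intro sets_rectangle I; auto intro!: cell bin_sets near_sets)+
  qed
  \<comment> \<open>Passing from \<open>E\<close> to \<open>F\<close> adds a condition of probability at most \<open>q\<close> on each radius whose index
    is not the first one in its cell; there are at least \<open>card I - card C\<close> such indices.\<close>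
  have prob_FE: "prob (F l) \<le> q ^ (card I - card C) * prob (E l)" if l: "l \<in> \<Lambda>" for l
  proof -
    obtain \<sigma> \<beta> where l_eq: "l = (\<sigma>, \<beta>)" by (cases l)
    define a where "a i = prob {\<omega> \<in> space M. \<xi> i \<omega> \<in> cell -` {\<sigma> i}}" for i
    define b where "b i = prob {\<omega> \<in> space M. R i \<omega> \<in> bin (\<beta> i)}" for i
    let ?x = "\<lambda>i. a i * (if i \<in> roots \<sigma> then b i else 1)"
    have cell': "cell -` {\<sigma> i} \<in> sets borel" if "i \<in> I" for i
      using \<sigma>C l that unfolding l_eq by (intro cell)
    have near_le: "prob {\<omega> \<in> space M. R i \<omega> \<in> near c} \<le> q" if "i \<in> I" for i c
      using prob_radius[of i "near c"] I(2) that near_sets q(3)[of "(of_int c - 1) * \<delta>"]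
      unfolding near_def by auto
    have "prob (F l) = prob {\<omega> \<in> space M. N \<omega> = m} *
        (\<Prod>i\<in>I. a i * prob {\<omega> \<in> space M. R i \<omega> \<in> (if i \<in> roots \<sigma> then bin (\<beta> i) else near (\<beta> (rep \<sigma> i)))})"
      unfolding l_eq F_def a_def prod.case
      by (intro prob_rectangle I) (auto intro!: cell' bin_sets near_sets)
    also have "\<dots> \<le> prob {\<omega> \<in> space M. N \<omega> = m} * (\<Prod>i\<in>I. ?x i * (if i \<in> roots \<sigma> then 1 else q))"
      by (intro mult_left_mono prod_mono)
        (auto simp: a_def b_def intro!: mult_left_mono near_le)
    also have "\<dots> = prob {\<omega> \<in> space M. N \<omega> = m} * (\<Prod>i\<in>I. ?x i) * q ^ card (I - roots \<sigma>)"
    proof -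
      have "(\<Prod>i\<in>I. if i \<in> roots \<sigma> then 1 else q) = (\<Prod>i\<in>I - roots \<sigma>. q)"
        using I(1) by (intro prod.mono_neutral_cong_right) auto
      then show ?thesis by (simp add: prod.distrib)
    qed
    also have "prob {\<omega> \<in> space M. N \<omega> = m} * (\<Prod>i\<in>I. ?x i) = prob (E l)"
    proof -
      have "prob {\<omega> \<in> space M. R i \<omega> \<in> (if i \<in> roots \<sigma> then bin (\<beta> i) else UNIV)} =
          (if i \<in> roots \<sigma> then b i else 1)" for i
        by (simp add: b_def prob_space)
      then show ?thesis
        unfolding l_eq E_def a_def prod.case
        by (subst prob_rectangle[OF I]) (auto intro!: cell' bin_sets)
    qed
    also have "prob (E l) * q ^ card (I - roots \<sigma>) \<le> prob (E l) * q ^ (card I - card C)"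
    proof (intro mult_left_mono power_decreasing q)
      have "card (I - roots \<sigma>) = card I - card (roots \<sigma>)"
        using I(1) roots_I by (intro card_Diff_subset finite_subset[OF roots_I I(1)])
      moreover have "card (roots \<sigma>) \<le> card C" using l unfolding l_eq by (intro card_roots) (simp add: \<Lambda>_def)
      ultimately show "card I - card C \<le> card (I - roots \<sigma>)" by simp
    qed simp
    finally show ?thesis by (simp add: mult.commute)
  qed
  have F_E: "F l \<subseteq> E l" for l unfolding E_def F_def by (auto split: prod.splits if_splits)
  have disjE: "disjoint_family_on E \<Lambda>"
    unfolding disjoint_family_on_def
  proof (intro ballI impI equals0I)
    fix l l' \<omega> assume l: "l \<in> \<Lambda>" "l' \<in> \<Lambda>" "l \<noteq> l'" and \<omega>: "\<omega> \<in> E l \<inter> E l'"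
    obtain \<sigma> \<beta> \<sigma>' \<beta>' where eq: "l = (\<sigma>, \<beta>)" "l' = (\<sigma>', \<beta>')" by (cases l, cases l')
    have \<sigma>: "\<sigma> = \<sigma>'"
    proof (rule extensionalityI[of _ I])
      show "\<sigma> \<in> extensional I" "\<sigma>' \<in> extensional I" using l unfolding eq \<Lambda>_def by (auto simp: PiE_def)
      fix i assume "i \<in> I"
      then show "\<sigma> i = \<sigma>' i" using \<omega> unfolding eq E_def by auto
    qed
    have "\<beta> = \<beta>'"
    proof (rule extensionalityI[of _ "roots \<sigma>"])
      show "\<beta> \<in> extensional (roots \<sigma>)" "\<beta>' \<in> extensional (roots \<sigma>)"
        using l unfolding eq \<Lambda>_def \<sigma> by (auto simp: PiE_def)
      fix i assume i: "i \<in> roots \<sigma>"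
      then have "i \<in> I" using roots_I by auto
      with i have "R i \<omega> \<in> bin (\<beta> i)" "R i \<omega> \<in> bin (\<beta>' i)"
        using \<omega> unfolding eq E_def \<sigma> by auto
      then show "\<beta> i = \<beta>' i" unfolding bin_def by simp
    qed
    with \<sigma> l(3) show False unfolding eq by simp
  qed
  have disjF: "disjoint_family_on F \<Lambda>"
    using disjE F_E unfolding disjoint_family_on_def by blast
  have G_F: "?G \<subseteq> (\<Union>l\<in>\<Lambda>. F l)"
  proof
    fix \<omega> assume \<omega>: "\<omega> \<in> ?G"
    define \<sigma> where "\<sigma> = restrict (\<lambda>i. cell (\<xi> i \<omega>)) I"
    define \<beta> where "\<beta> = restrict (\<lambda>i. \<lfloor>R i \<omega> / \<delta>\<rfloor>) (roots \<sigma>)"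
    have "(\<sigma>, \<beta>) \<in> \<Lambda>" using \<omega> unfolding \<Lambda>_def \<sigma>_def \<beta>_def by auto
    moreover have "\<omega> \<in> F (\<sigma>, \<beta>)"
      unfolding F_def prod.case
    proof (intro CollectI conjI ballI)
      show "\<omega> \<in> space M" "N \<omega> = m" using \<omega> by auto
      fix i assume i: "i \<in> I"
      show "\<xi> i \<omega> \<in> cell -` {\<sigma> i}" using i by (simp add: \<sigma>_def)
      show "R i \<omega> \<in> (if i \<in> roots \<sigma> then bin (\<beta> i) else near (\<beta> (rep \<sigma> i)))"
      proof (cases "i \<in> roots \<sigma>")
        case True
        then show ?thesis by (simp add: \<beta>_def bin_def)
      next
        case False
        define s where "s = R (rep \<sigma> i) \<omega>"
        have "cell (\<xi> (rep \<sigma> i) \<omega>) = cell (\<xi> i \<omega>)" using rep[OF i, of \<sigma>] i by (simp add: \<sigma>_def)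
        then have d: "\<bar>R i \<omega> - s\<bar> \<le> \<delta>"
          using \<omega> rep(1)[OF i, of \<sigma>] i unfolding s_def by force
        have \<beta>: "\<beta> (rep \<sigma> i) = \<lfloor>s / \<delta>\<rfloor>" using i by (simp add: \<beta>_def roots_def s_def)
        have "of_int \<lfloor>s / \<delta>\<rfloor> * \<delta> \<le> s" "s < (of_int \<lfloor>s / \<delta>\<rfloor> + 1) * \<delta>"
          using floor_divide_lower[OF \<delta>, of s] floor_divide_upper[OF \<delta>, of s] by auto
        then have "R i \<omega> \<in> near (\<beta> (rep \<sigma> i))"
          using d unfolding near_def \<beta> by (auto simp: algebra_simps abs_le_iff)
        then show ?thesis using False by simp
      qed
    qed
    ultimately show "\<omega> \<in> (\<Union>l\<in>\<Lambda>. F l)" by blast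
  qed
  let ?q = "q ^ (card I - card C)"
  note [measurable] = rv_number
  have UF: "(\<Union>l\<in>\<Lambda>. F l) \<in> events" and UE: "(\<Union>l\<in>\<Lambda>. E l) \<in> events"
    using F_sets E_sets count by (auto intro!: sets.countable_UN')
  have "ennreal (prob (\<Union>l\<in>\<Lambda>. F l)) = (\<integral>\<^sup>+l. emeasure M (F l) \<partial>count_space \<Lambda>)"
    unfolding emeasure_eq_measure[symmetric] by (intro emeasure_UN_countable F_sets count disjF)
  also have "\<dots> \<le> (\<integral>\<^sup>+l. ennreal ?q * emeasure M (E l) \<partial>count_space \<Lambda>)"
    using q prob_FE
    by (intro nn_integral_mono) (simp add: emeasure_eq_measure ennreal_mult[symmetric])
  also have "\<dots> = ennreal ?q * (\<integral>\<^sup>+l. emeasure M (E l) \<partial>count_space \<Lambda>)"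
    by (rule nn_integral_cmult) simp
  also have "(\<integral>\<^sup>+l. emeasure M (E l) \<partial>count_space \<Lambda>) = ennreal (prob (\<Union>l\<in>\<Lambda>. E l))"
    unfolding emeasure_eq_measure[symmetric]
    by (intro emeasure_UN_countable[symmetric] E_sets count disjE)
  also have "\<dots> \<le> ennreal (prob {\<omega> \<in> space M. N \<omega> = m})"
    by (intro ennreal_leI finite_measure_mono) (auto simp: E_def)
  finally have "ennreal (prob (\<Union>l\<in>\<Lambda>. F l)) \<le> ennreal (?q * prob {\<omega> \<in> space M. N \<omega> = m})"
    using q by (simp add: ennreal_mult mult_left_mono)
  then have "prob (\<Union>l\<in>\<Lambda>. F l) \<le> ?q * prob {\<omega> \<in> space M. N \<omega> = m}"
    using q by (subst (asm) ennreal_le_iff) auto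
  moreover have "prob ?G \<le> prob (\<Union>l\<in>\<Lambda>. F l)" by (intro finite_measure_mono G_F UF)
  ultimately show ?thesis by (simp add: mult.commute)
qed

text \<open>The sum over all \<open>n\<close>-element subsets of the indices \<open>{1..m}\<close> and over the values \<open>m\<close> of the
  Poisson variable is a binomial moment, which produces the factor \<open>rate ^ n / fact n\<close>.\<close>

lemma prob_le_cover_number_le:
  fixes cell :: "real ^ 'd \<Rightarrow> 'c" and C :: "'c set"
  assumes norm: "is_norm \<nu>" and n: "2 \<le> n" and C: "finite C"
    and cell: "\<And>c. c \<in> C \<Longrightarrow> cell -` {c} \<in> sets borel"
    and cellC: "\<And>x. x \<in> unit_cube \<Longrightarrow> cell x \<in> C"
    and diam: "\<And>x y. cell x = cell y \<Longrightarrow> \<nu> (x - y) \<le> \<delta>"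
    and \<delta>: "0 < \<delta>" and q: "0 \<le> q" "q \<le> 1" "\<And>a. prob {\<omega> \<in> space M. R 1 \<omega> \<in> {a..a + 3 * \<delta>}} \<le> q"
  shows "prob {\<omega> \<in> space M. n \<le> cover_number \<nu> \<xi> R N \<omega>} \<le> rate ^ n / fact n * q ^ (n - card C)"
proof -
  define G where "G m I = {\<omega> \<in> space M. N \<omega> = m \<and> (\<forall>i\<in>I. cell (\<xi> i \<omega>) \<in> C) \<and>
      (\<forall>i\<in>I. \<forall>j\<in>I. cell (\<xi> i \<omega>) = cell (\<xi> j \<omega>) \<longrightarrow> \<bar>R i \<omega> - R j \<omega>\<bar> \<le> \<delta>)}" for m I
  define S where "S m = {I. I \<subseteq> {1..m} \<and> card I = n}" for m :: nat
  let ?p = "\<lambda>m. real (m choose n) * (rate ^ m / fact m * exp (- rate))"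
  have S: "finite (S m)" "card (S m) = m choose n" for m
    unfolding S_def using n_subsets[of "{1..m}" n] by (auto intro: finite_subset[of _ "Pow {1..m}"])
  have SI: "finite I" "I \<subseteq> {1..}" "card I = n" if "I \<in> S m" for I m
    using that unfolding S_def by (auto intro: finite_subset)
  have G_sets: "G m I \<in> events" if I: "I \<in> S m" for m I
  proof -
    note [measurable] = rv_number
    have eq: "G m I = {\<omega> \<in> space M. N \<omega> = m \<and> (\<forall>i\<in>I. \<exists>c\<in>C. \<xi> i \<omega> \<in> cell -` {c}) \<and>
      (\<forall>i\<in>I. \<forall>j\<in>I. (\<exists>c\<in>C. \<xi> i \<omega> \<in> cell -` {c} \<and> \<xi> j \<omega> \<in> cell -` {c}) \<longrightarrow> \<bar>R i \<omega> - R j \<omega>\<bar> \<le> \<delta>)}"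
      unfolding G_def by auto
    have [measurable]: "\<xi> i \<in> borel_measurable M" "R i \<in> borel_measurable M" if "i \<in> I" for i
      using that SI(2)[OF I] rv_centre rv_radius by auto
    note [measurable] = cell SI(1)[OF I] C
    show ?thesis unfolding eq by measurable
  qed
  have G_le: "prob (G m I) \<le> (rate ^ m / fact m * exp (- rate)) * q ^ (n - card C)" if I: "I \<in> S m" for m I
    using prob_radii_close_le[OF SI(1,2)[OF I] C cell \<delta> q, of m] SI(3)[OF I]
    unfolding G_def prob_number by simp
  have AE_cube: "AE \<omega> in M. \<forall>i\<in>{1..}. \<xi> i \<omega> \<in> unit_cube"
  proof (subst AE_ball_countable, simp, rule ballI)
    fix i :: nat assume "i \<in> {1..}"
    then have i: "1 \<le> i" by simp
    note [measurable] = rv_centre[OF i]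
    have "prob {\<omega> \<in> space M. \<xi> i \<omega> \<in> unit_cube} = 1"
      using i measure_lborel_unit_cube[where 'd = 'd] by (subst prob_centre) auto
    then show "AE \<omega> in M. \<xi> i \<omega> \<in> unit_cube"
      by (subst prob_Collect_eq_1[symmetric]) measurable
  qed
  have cover: "\<omega> \<in> (\<Union>m. \<Union>I\<in>S m. G m I)"
    if \<omega>: "\<omega> \<in> space M" and K: "n \<le> cover_number \<nu> \<xi> R N \<omega>" and cube: "\<forall>i\<in>{1..}. \<xi> i \<omega> \<in> unit_cube" for \<omega>
  proof -
    obtain I where I: "I \<subseteq> {1..N \<omega>}" "card I = n"
      "\<And>i j. i \<in> I \<Longrightarrow> j \<in> I \<Longrightarrow> \<bar>R i \<omega> - R j \<omega>\<bar> \<le> \<nu> (\<xi> i \<omega> - \<xi> j \<omega>)"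
      using cover_number_imp_radii_close[OF norm n K] by metis
    have "\<omega> \<in> G (N \<omega>) I"
      unfolding G_def using \<omega> I cube cellC by (force intro: order_trans[OF _ diam])
    moreover have "I \<in> S (N \<omega>)" using I unfolding S_def by simp
    ultimately show ?thesis by blast
  qed
  have UG: "(\<Union>I\<in>S m. G m I) \<in> events" for m using S(1) G_sets by (intro sets.finite_UN) auto
  have UG_le: "prob (\<Union>I\<in>S m. G m I) \<le> ?p m * q ^ (n - card C)" for m
  proof -
    have "prob (\<Union>I\<in>S m. G m I) \<le> (\<Sum>I\<in>S m. prob (G m I))"
      using S(1) G_sets by (intro finite_measure_subadditive_finite) auto
    also have "\<dots> \<le> (\<Sum>I\<in>S m. (rate ^ m / fact m * exp (- rate)) * q ^ (n - card C))"
      by (intro sum_mono G_le)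
    finally show ?thesis by (simp add: S mult.assoc)
  qed
  have sums: "(\<lambda>m. ?p m * q ^ (n - card C)) sums (rate ^ n / fact n * q ^ (n - card C))"
    by (intro sums_mult2 binomial_moment_poisson_sums)
  have summable: "summable (\<lambda>m. prob (\<Union>I\<in>S m. G m I))"
    using UG_le by (intro summable_comparison_test'[OF sums_summable[OF sums]]) auto
  have "prob {\<omega> \<in> space M. n \<le> cover_number \<nu> \<xi> R N \<omega>} \<le> prob (\<Union>m. \<Union>I\<in>S m. G m I)"
  proof (rule finite_measure_mono_AE)
    show "AE \<omega> in M. \<omega> \<in> {\<omega> \<in> space M. n \<le> cover_number \<nu> \<xi> R N \<omega>} \<longrightarrow> \<omega> \<in> (\<Union>m. \<Union>I\<in>S m. G m I)"
      using AE_cube by eventually_elim (auto dest!: cover)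
    show "(\<Union>m. \<Union>I\<in>S m. G m I) \<in> events" using UG by blast
  qed
  also have "\<dots> \<le> (\<Sum>m. prob (\<Union>I\<in>S m. G m I))"
    using UG summable by (intro finite_measure_subadditive_countably) auto
  also have "\<dots> \<le> (\<Sum>m. ?p m * q ^ (n - card C))"
    by (intro suminf_le UG_le summable sums_summable[OF sums])
  also have "\<dots> = rate ^ n / fact n * q ^ (n - card C)" using sums by (rule sums_unique[symmetric])
  finally show ?thesis .
qed

end

section \<open>Asymptotics\<close>

lemma ge_exp_nlognI:
  assumes "0 < a" "0 < b" "0 < c"
    and ge: "\<forall>\<^sub>F n in sequentially. b * (c * real n powr (- a)) ^ n \<le> f n"
  shows "ge_exp_nlogn f a"
  unfolding ge_exp_nlogn_def
proof (intro exI conjI)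
  define \<epsilon> where "\<epsilon> n = - (ln b + real n * ln c) / (a * real n * ln (real n))" for n :: nat
  show "\<epsilon> \<longlonglongrightarrow> 0" unfolding \<epsilon>_def using assms(1) by real_asymp
  show "\<forall>\<^sub>F n in sequentially. exp (- a * real n * ln (real n) * (1 + \<epsilon> n)) \<le> f n"
    using ge eventually_ge_at_top[of 2]
  proof eventually_elim
    case (elim n)
    then have n: "0 < real n" "0 < ln (real n)" by auto
    have "- a * real n * ln (real n) * (1 + \<epsilon> n) = ln b + real n * (ln c + (- a) * ln (real n))"
      unfolding \<epsilon>_def using n assms by (simp add: field_simps)
    also have "exp \<dots> = b * exp (ln c + (- a) * ln (real n)) ^ n"
      using assms by (simp add: exp_add exp_of_nat_mult)
    also have "exp (ln c + (- a) * ln (real n)) = c * real n powr (- a)"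
      using assms n by (subst exp_add) (simp add: powr_def)
    finally show ?case using elim by simp
  qed
qed

lemma le_exp_nlognI:
  assumes "0 < a"
    and le: "\<forall>\<^sub>F n in sequentially. f n \<le> exp (g n)"
    and lim: "(\<lambda>n. g n / (real n * ln (real n))) \<longlonglongrightarrow> - a"
  shows "le_exp_nlogn f a"
  unfolding le_exp_nlogn_def
proof (intro exI conjI)
  define \<epsilon> where "\<epsilon> n = g n / (real n * ln (real n)) / (- a) - 1" for n :: nat
  have "\<epsilon> \<longlonglongrightarrow> (- a) / (- a) - 1"
    unfolding \<epsilon>_def using assms(1) by (intro tendsto_intros lim) auto
  then show "\<epsilon> \<longlonglongrightarrow> 0" using assms(1) by simp
  show "\<forall>\<^sub>F n in sequentially. f n \<le> exp (- a * real n * ln (real n) * (1 + \<epsilon> n))"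
    using le eventually_ge_at_top[of 2]
  proof eventually_elim
    case (elim n)
    then have n: "0 < real n" "0 < ln (real n)" by auto
    have "- a * real n * ln (real n) * (1 + \<epsilon> n) = g n"
      unfolding \<epsilon>_def using n assms(1) by (simp add: field_simps)
    with elim show ?case by simp
  qed
qed

text \<open>Turns an estimate for a grid with \<open>k\<close> cells per side in dimension \<open>m\<close> into asymptotics: \<open>k\<close>
  is the least number with \<open>n \<le> k ^ m\<close>, so that \<open>n\<close> different cells are available and \<open>k\<close> is
  comparable to the \<open>m\<close>-th root of \<open>n\<close>.\<close>

lemma ge_exp_nlogn_of_grid:
  assumes "0 < b" "0 < A" "0 < \<beta>" "0 < m"
    and ge: "\<And>k n. k0 \<le> k \<Longrightarrow> 1 \<le> k \<Longrightarrow> 1 \<le> n \<Longrightarrow> n \<le> k ^ m \<Longrightarrow>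
      b * (A * real k powr (- \<beta>)) ^ n \<le> f n"
  shows "ge_exp_nlogn f (\<beta> / real m)"
proof (rule ge_exp_nlognI[of _ b "A * 2 powr (- \<beta>)"])
  define x where "x n = real n powr (1 / real m)" for n :: nat
  have "filterlim x at_top sequentially" unfolding x_def using assms(4) by real_asymp
  then have "\<forall>\<^sub>F n in sequentially. real k0 \<le> x n" by (simp add: filterlim_at_top)
  then show "\<forall>\<^sub>F n in sequentially. b * (A * 2 powr (- \<beta>) * real n powr (- (\<beta> / real m))) ^ n \<le> f n"
    using eventually_ge_at_top[of 1]
  proof eventually_elim
    case (elim n)
    define k where "k = nat \<lceil>x n\<rceil>"
    have x1: "1 \<le> x n" unfolding x_def using elim by (intro ge_one_powr_ge_zero) auto
    have k: "x n \<le> real k" "real k \<le> 2 * x n" unfolding k_def using x1 by linarith+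
    have "real n = x n ^ m" unfolding x_def using elim assms(4) by (simp add: powr_powr flip: powr_realpow)
    also have "\<dots> \<le> real k ^ m" using k x1 by (intro power_mono) auto
    finally have nk: "n \<le> k ^ m" by (metis of_nat_le_iff of_nat_power)
    have "real n powr (- (\<beta> / real m)) = x n powr (- \<beta>)" unfolding x_def by (simp add: powr_powr)
    then have "2 powr (- \<beta>) * real n powr (- (\<beta> / real m)) = (2 * x n) powr (- \<beta>)"
      using x1 by (simp add: powr_mult)
    also have "\<dots> \<le> real k powr (- \<beta>)" using k x1 assms(3) by (intro powr_mono2') auto
    finally have "b * (A * (2 powr (- \<beta>) * real n powr (- (\<beta> / real m)))) ^ n \<le> b * (A * real k powr (- \<beta>)) ^ n"
      using assms by (intro mult_left_mono power_mono) auto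
    also have "\<dots> \<le> f n" using k x1 elim nk by (intro ge) linarith+
    finally show ?case by (simp add: mult.assoc)
  qed
qed (use assms in auto)

lemma power_le_exp_mult_fact: "real n ^ n \<le> exp (real n) * fact n"
proof -
  have "real n ^ n /\<^sub>R fact n \<le> exp (real n)"
    unfolding exp_def using summable_exp_generic[of "real n"]
      sum_le_suminf[of "\<lambda>i. real n ^ i /\<^sub>R fact i" "{n}"] by simp
  then show ?thesis by (simp add: field_simps)
qed

text \<open>With about \<open>n / ln n\<close> cells, the exponent of \<open>A / k\<close> is still \<open>n - o(n)\<close>, while \<open>1 / k\<close> is as
  small as \<open>n powr (- 1 / m + o(1))\<close>.\<close>

lemma le_exp_nlogn_of_grid:
  assumes r: "0 < r" and A: "0 < A" and m: "0 < m"
    and le: "\<And>k n. 2 \<le> n \<Longrightarrow> 1 \<le> k \<Longrightarrow> A \<le> real k \<Longrightarrow>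
      f n \<le> r ^ n / fact n * (A / real k) ^ (n - (k + 1) ^ m)"
  shows "le_exp_nlogn f (1 + 1 / real m)"
proof (rule le_exp_nlognI)
  define x where "x n = (real n / ln (real n)) powr (1 / real m)" for n :: nat
  define g where "g n = real n * ln r - (real n * ln (real n) - real n)
    + (real n - real n / ln (real n)) * (ln A - ln (x n - 2))" for n :: nat
  have m': "0 < real m" using m by simp
  show "(\<lambda>n. g n / (real n * ln (real n))) \<longlonglongrightarrow> - (1 + 1 / real m)"
    unfolding g_def x_def using m' by (real_asymp simp: field_simps)
  have "filterlim x at_top sequentially" unfolding x_def using m' by real_asymp
  then have "\<forall>\<^sub>F n in sequentially. A + 4 \<le> x n" by (simp add: filterlim_at_top)
  moreover have "\<forall>\<^sub>F n in sequentially. 1 \<le> ln (real n)" by real_asymp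
  ultimately show "\<forall>\<^sub>F n in sequentially. f n \<le> exp (g n)"
    using eventually_ge_at_top[of 2]
  proof eventually_elim
    case (elim n)
    define k where "k = nat \<lfloor>x n\<rfloor> - 1"
    have k: "real k + 1 \<le> x n" "x n - 2 \<le> real k" unfolding k_def using elim A by linarith+
    have k1: "1 \<le> k" "A \<le> real k" "A \<le> x n - 2" using k elim A by linarith+
    define e where "e = n - (k + 1) ^ m"
    have "real ((k + 1) ^ m) \<le> x n ^ m" using k by (simp add: power_mono add.commute)
    also have "\<dots> = real n / ln (real n)"
      unfolding x_def using elim m by (simp add: powr_powr flip: powr_realpow)
    finally have "real ((k + 1) ^ m) \<le> real n / ln (real n)" .
    then have e: "real n - real n / ln (real n) \<le> real e" unfolding e_def by linarith
    have "(A / real k) ^ e = (A / real k) powr real e" using k1 A by (simp add: powr_realpow)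
    also have "\<dots> \<le> (A / (x n - 2)) powr real e"
      using k k1 A by (intro powr_mono2 divide_left_mono) auto
    also have "\<dots> \<le> (A / (x n - 2)) powr (real n - real n / ln (real n))"
      using k1 A e by (intro powr_mono') (auto simp: divide_le_eq)
    also have "\<dots> = exp ((real n - real n / ln (real n)) * (ln A - ln (x n - 2)))"
      using k1 A by (simp add: powr_def ln_div)
    finally have 1: "(A / real k) ^ e \<le> exp ((real n - real n / ln (real n)) * (ln A - ln (x n - 2)))" .
    have "1 / fact n \<le> exp (real n) / real n ^ n"
      using power_le_exp_mult_fact[of n] elim by (simp add: field_simps)
    also have "\<dots> = exp (- (real n * ln (real n) - real n))"
      using elim by (simp add: exp_diff exp_minus exp_of_nat_mult field_simps)
    finally have 2: "1 / fact n \<le> exp (- (real n * ln (real n) - real n))" .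
    have "f n \<le> r ^ n * (1 / fact n) * (A / real k) ^ e"
      using le[of n k] elim k1 unfolding e_def by simp
    also have "\<dots> \<le> exp (real n * ln r) * exp (- (real n * ln (real n) - real n)) *
        exp ((real n - real n / ln (real n)) * (ln A - ln (x n - 2)))"
      using 1 2 r A by (intro mult_mono) (auto simp: exp_of_nat_mult)
    also have "\<dots> = exp (g n)" unfolding g_def by (simp flip: exp_add)
    finally show ?case .
  qed
qed (use m in \<open>simp add: add_pos_nonneg\<close>)

section \<open>Grids of boxes\<close>

text \<open>The steps \<open>s\<close> of the grid and the widths \<open>w\<close> of the boxes are independent of each other, because
  centres in different cells have to keep a distance in some directions (\<open>w i < s i\<close>) while the
  cells may touch in others (\<open>w i = s i\<close>, disjoint as the boxes are open).\<close>

definition grid_box :: "('d \<Rightarrow> real) \<Rightarrow> ('d \<Rightarrow> real) \<Rightarrow> ('d \<Rightarrow> nat) \<Rightarrow> (real ^ 'd) set" where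
  "grid_box s w g = box (\<chi> i. real (g i) * s i) (\<chi> i. real (g i) * s i + w i)"

lemma mem_grid_box:
  "x \<in> grid_box s w g \<longleftrightarrow> (\<forall>i. real (g i) * s i < x $ i \<and> x $ i < real (g i) * s i + w i)"
  by (simp add: grid_box_def mem_box_cart)

lemma sets_grid_box: "grid_box s w g \<in> sets borel"
  by (simp add: grid_box_def)

lemma measure_grid_box:
  fixes s :: "'d::finite \<Rightarrow> real"
  assumes "\<And>i. 0 < w i"
  shows "measure lborel (grid_box s w g) = (\<Prod>i\<in>UNIV. w i)"
proof -
  let ?a = "(\<chi> i. real (g i) * s i) :: real ^ 'd"
  let ?b = "(\<chi> i. real (g i) * s i + w i) :: real ^ 'd"
  have "?a \<in> cbox ?a ?b" using assms by (simp add: mem_box_cart less_imp_le)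
  then have ne: "cbox ?a ?b \<noteq> {}" by blast
  have "measure lborel (box ?a ?b) = measure lborel (cbox ?a ?b)"
    using ne by (subst measure_lborel_box) (auto simp: box_ne_empty)
  also have "\<dots> = (\<Prod>i\<in>UNIV. w i)" using content_cbox_cart[OF ne] by simp
  finally show ?thesis unfolding grid_box_def .
qed

lemma grid_box_subset_unit_cube:
  assumes "\<And>i. 0 < s i" "\<And>i. w i \<le> s i" "\<And>i. real (g i + 1) * s i \<le> 1"
  shows "grid_box s w g \<subseteq> unit_cube"
proof
  fix x assume x: "x \<in> grid_box s w g"
  have "0 \<le> x $ i \<and> x $ i \<le> 1" for i
  proof -
    have "0 \<le> real (g i) * s i" using assms(1)[of i] by simp
    moreover have "real (g i) * s i + w i \<le> 1" using assms(2,3)[of i] by (simp add: algebra_simps)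
    moreover have "real (g i) * s i < x $ i" "x $ i < real (g i) * s i + w i"
      using x by (auto simp: mem_grid_box)
    ultimately show ?thesis by linarith
  qed
  then show "x \<in> unit_cube" by (simp add: mem_box_cart)
qed

lemma grid_box_separated:
  assumes x: "x \<in> grid_box s w g" and x': "x' \<in> grid_box s w g'" and ne: "g i \<noteq> g' i" and s: "0 < s i"
  shows "s i - w i < \<bar>x $ i - x' $ i\<bar>"
proof -
  have *: "s i - w i < y $ i - y' $ i"
    if "y \<in> grid_box s w h" "y' \<in> grid_box s w h'" "h' i < h i" for h h' y y'
  proof -
    have "real (h' i) + 1 \<le> real (h i)" using that(3) by linarith
    then have "(real (h' i) + 1) * s i \<le> real (h i) * s i" using s by (intro mult_right_mono) auto
    then have "real (h' i) * s i + s i \<le> real (h i) * s i" by (simp add: algebra_simps)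
    moreover have "real (h i) * s i < y $ i" "y' $ i < real (h' i) * s i + w i"
      using that(1,2) by (auto simp: mem_grid_box)
    ultimately show ?thesis by linarith
  qed
  show ?thesis
  proof (cases "g i < g' i")
    case True
    then show ?thesis using *[OF x' x] by simp
  next
    case False
    then show ?thesis using *[OF x x'] ne by simp
  qed
qed

lemma grid_box_disjoint:
  assumes "\<And>i. 0 < s i" "\<And>i. w i \<le> s i" "g \<noteq> g'"
  shows "grid_box s w g \<inter> grid_box s w g' = {}"
proof (rule equals0I)
  fix x assume x: "x \<in> grid_box s w g \<inter> grid_box s w g'"
  obtain i where "g i \<noteq> g' i" using assms(3) by blast
  then have "s i - w i < \<bar>x $ i - x $ i\<bar>" using x assms(1) by (intro grid_box_separated) auto
  then show False using assms(2)[of i] by simp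
qed

section \<open>The density of the radii\<close>

lemma measure_interval_of_density:
  fixes p :: "real \<Rightarrow> real"
  assumes M: "prob_space M" and density: "distributed M lborel X (\<lambda>z. ennreal (indicator {0<..} z * p z))"
  shows "(\<And>z. 0 < z \<Longrightarrow> p z \<le> U) \<Longrightarrow> 0 \<le> U \<Longrightarrow> s \<le> t \<Longrightarrow>
      measure M {\<omega> \<in> space M. X \<omega> \<in> {s..t}} \<le> U * (t - s)"
    and "(\<And>z. s \<le> z \<Longrightarrow> z \<le> t \<Longrightarrow> L \<le> p z) \<Longrightarrow> 0 \<le> L \<Longrightarrow> 0 < s \<Longrightarrow> s \<le> t \<Longrightarrow>
      L * (t - s) \<le> measure M {\<omega> \<in> space M. X \<omega> \<in> {s..t}}"
proof -
  interpret prob_space M by fact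
  let ?f = "\<lambda>z. ennreal (indicator {0<..} z * p z)"
  have "emeasure M (X -` {s..t} \<inter> space M) = (\<integral>\<^sup>+z. ?f z * indicator {s..t} z \<partial>lborel)"
    using density by (rule distributed_emeasure) simp
  moreover have "X -` {s..t} \<inter> space M = {\<omega> \<in> space M. X \<omega> \<in> {s..t}}" by auto
  ultimately have eq: "ennreal (prob {\<omega> \<in> space M. X \<omega> \<in> {s..t}}) = (\<integral>\<^sup>+z. ?f z * indicator {s..t} z \<partial>lborel)"
    by (simp add: emeasure_eq_measure)
  show "prob {\<omega> \<in> space M. X \<omega> \<in> {s..t}} \<le> U * (t - s)"
    if U: "\<And>z. 0 < z \<Longrightarrow> p z \<le> U" "0 \<le> U" "s \<le> t"
  proof -
    have "(\<integral>\<^sup>+z. ?f z * indicator {s..t} z \<partial>lborel) \<le> (\<integral>\<^sup>+z. ennreal U * indicator {s..t} z \<partial>lborel)"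
      using U by (intro nn_integral_mono mult_right_mono ennreal_leI) (auto simp: indicator_def)
    also have "\<dots> = ennreal (U * (t - s))" using U by (simp add: nn_integral_cmult_indicator ennreal_mult)
    finally show ?thesis using U unfolding eq[symmetric] by (subst (asm) ennreal_le_iff) auto
  qed
  show "L * (t - s) \<le> prob {\<omega> \<in> space M. X \<omega> \<in> {s..t}}"
    if L: "\<And>z. s \<le> z \<Longrightarrow> z \<le> t \<Longrightarrow> L \<le> p z" "0 \<le> L" "0 < s" "s \<le> t"
  proof -
    have "ennreal (L * (t - s)) = (\<integral>\<^sup>+z. ennreal L * indicator {s..t} z \<partial>lborel)"
      using L by (simp add: nn_integral_cmult_indicator ennreal_mult)
    also have "\<dots> \<le> (\<integral>\<^sup>+z. ?f z * indicator {s..t} z \<partial>lborel)"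
      using L by (intro nn_integral_mono) (auto simp: indicator_def intro!: ennreal_leI)
    finally show ?thesis unfolding eq[symmetric] by (subst (asm) ennreal_le_iff) auto
  qed
qed

text \<open>For \<open>\<alpha> < 1\<close>, the function \<open>z powr (\<alpha> - 1)\<close> tends to infinity at 0. For \<open>\<alpha> \<ge> 1\<close> it is
  increasing, so its value at the left end of an interval bounds the density from below.\<close>

lemma exponent_ge_1_if_bounded:
  assumes comp: "comparable_at_0 p (\<lambda>z. z powr (\<alpha> - 1))" and bdd: "bounded (p ` {0<..})"
  shows "1 \<le> \<alpha>"
proof (rule ccontr)
  assume "\<not> 1 \<le> \<alpha>"
  then have \<alpha>: "\<alpha> < 1" by simp
  obtain c C where c: "0 < c"
    "\<forall>\<^sub>F z in at_right 0. c \<le> p z / z powr (\<alpha> - 1) \<and> p z / z powr (\<alpha> - 1) \<le> C"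
    using comp unfolding comparable_at_0_def by blast
  obtain B where B: "\<And>z. 0 < z \<Longrightarrow> p z \<le> B"
    using bdd unfolding bounded_iff by (force simp: abs_le_iff)
  have "filterlim (\<lambda>z::real. z powr (\<alpha> - 1)) at_top (at_right 0)"
    using \<alpha> by real_asymp
  then have "\<forall>\<^sub>F z in at_right 0. B / c < z powr (\<alpha> - 1)"
    unfolding filterlim_at_top_dense by blast
  with c(2) eventually_at_right_less have "\<forall>\<^sub>F z in at_right (0::real). False"
  proof eventually_elim
    case (elim z)
    then have "c * z powr (\<alpha> - 1) \<le> p z" by (simp add: pos_le_divide_eq)
    moreover have "B < c * z powr (\<alpha> - 1)" using elim c(1) by (simp add: pos_divide_less_eq mult.commute)
    ultimately show ?case using B[of z] elim by linarith
  qed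
  then show False by simp
qed

section \<open>Proofs of the four bounds\<close>

context random_balls
begin

lemma prob_grid_box:
  assumes "\<And>i. 0 < w i" "\<And>i. w i \<le> s i" "\<And>i. real (g i + 1) * s i \<le> 1"
  shows "prob {\<omega> \<in> space M. \<xi> 1 \<omega> \<in> grid_box s w g} = (\<Prod>i\<in>UNIV. w i)"
proof -
  have "0 < s i" for i using assms(1,2)[of i] by linarith
  then have "grid_box s w g \<inter> unit_cube = grid_box s w g"
    using grid_box_subset_unit_cube[of s w g] assms by blast
  then show ?thesis
    using prob_centre[of 1 "grid_box s w g"] measure_grid_box[of w s g] sets_grid_box[of s w g] assms(1)
    by simp
qed

text \<open>Disjoint balls: if the radii are small against the mesh of the grid, then no centre is in
  another ball.\<close>

lemma ge_exp_nlogn_small_balls: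
  assumes norm: "is_norm \<nu>" and \<kappa>: "0 < \<kappa>" and z0: "0 < z0" and \<alpha>: "0 < \<alpha>"
    and R: "\<And>h. 0 < h \<Longrightarrow> h < z0 \<Longrightarrow> \<kappa> * h powr \<alpha> \<le> prob {\<omega> \<in> space M. R 1 \<omega> \<in> {h / 2..h}}"
  shows "ge_exp_nlogn (\<lambda>n. prob {\<omega> \<in> space M. n \<le> cover_number \<nu> \<xi> R N \<omega>}) (1 + \<alpha> / real CARD('d))"
proof -
  obtain c where c: "0 < c" "\<And>x. c * norm x \<le> \<nu> x" using is_norm_ge[OF norm] by blast
  let ?d = "CARD('d)"
  define A where "A = rate * (1 / 2) ^ ?d * (\<kappa> * (c / 2) powr \<alpha>)"
  have zero: "\<nu> 0 = 0" using norm unfolding is_norm_def by blast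
  have "ge_exp_nlogn (\<lambda>n. prob {\<omega> \<in> space M. n \<le> cover_number \<nu> \<xi> R N \<omega>}) ((real ?d + \<alpha>) / real ?d)"
  proof (rule ge_exp_nlogn_of_grid)
    show "0 < exp (- rate)" "0 < A" "0 < real ?d + \<alpha>" "0 < ?d"
      unfolding A_def using rate_pos \<kappa> c \<alpha> by (auto intro!: add_pos_pos)
    fix k n :: nat
    assume k0: "nat \<lceil>c / z0\<rceil> \<le> k" and k: "1 \<le> k" and n: "1 \<le> n" "n \<le> k ^ ?d"
    define h where "h = c / (2 * real k)"
    have kz: "c / z0 \<le> real k" using k0 by linarith
    have h: "0 < h" "h < z0"
    proof -
      show "0 < h" unfolding h_def using c k by simp
      have "c \<le> real k * z0" using kz z0 by (simp add: pos_divide_le_eq)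
      moreover have "0 < real k * z0" using k z0 by simp
      ultimately show "h < z0" unfolding h_def using k by (simp add: divide_less_eq mult_ac)
    qed
    define s where "s = (\<lambda>i::'d. 1 / real k)"
    define w where "w = (\<lambda>i::'d. 1 / (2 * real k))"
    define G where "G = (UNIV \<rightarrow>\<^sub>E {..<k} :: ('d \<Rightarrow> nat) set)"
    have sw: "0 < s i" "0 < w i" "w i \<le> s i" "s i - w i = 1 / (2 * real k)" for i
      unfolding s_def w_def using k by (auto simp: field_simps)
    have G: "real (g i + 1) * s i \<le> 1" if "g \<in> G" for g i
    proof -
      have "g i + 1 \<le> k" using PiE_mem[of g UNIV "\<lambda>_. {..<k}" i] that unfolding G_def by simp
      then show ?thesis unfolding s_def using k by (simp add: divide_le_eq)
    qed
    have "exp (- rate) * (rate * real (card {()}) * (\<Prod>i\<in>(UNIV::'d set). w i) * (\<kappa> * h powr \<alpha>)) ^ n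
        \<le> prob {\<omega> \<in> space M. n \<le> cover_number \<nu> \<xi> R N \<omega>}"
    proof (rule prob_le_cover_number_ge[OF norm n(1), where G = G and D = "\<lambda>g _. grid_box s w g"
          and T = "\<lambda>_. {h / 2..h}" and tip = "\<lambda>x r. x"])
      show "finite G" unfolding G_def by (intro finite_PiE) auto
      show "n \<le> card G" unfolding G_def using n by (simp add: card_funcsetE)
      show "grid_box s w g \<inter> grid_box s w g' = {}" if "(g, j) \<noteq> (g', j')" for g g' and j j' :: unit
        using that sw by (intro grid_box_disjoint) auto
      show "(\<Prod>i\<in>(UNIV::'d set). w i) \<le> prob {\<omega> \<in> space M. \<xi> 1 \<omega> \<in> grid_box s w g}" if "g \<in> G" for g
        using prob_grid_box[of w s g] sw G[OF that] by simp
      show "0 \<le> (\<Prod>i\<in>(UNIV::'d set). w i)" using sw by (intro prod_nonneg) (auto intro: less_imp_le)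
      show "0 \<le> \<kappa> * h powr \<alpha>" using \<kappa> by simp
      show "\<kappa> * h powr \<alpha> \<le> prob {\<omega> \<in> space M. R 1 \<omega> \<in> {h / 2..h}}" by (rule R[OF h])
      show "x \<in> unit_cube \<and> \<nu> (x - x) \<le> r" if "g \<in> G" "x \<in> grid_box s w g" "r \<in> {h / 2..h}" for g x r
        using grid_box_subset_unit_cube[of s w g] sw G[OF that(1)] that h zero by auto
      show "r' < \<nu> (x - x')" if x: "x \<in> grid_box s w g" "x' \<in> grid_box s w g'"
        and r': "r' \<in> {h / 2..h}" and ne: "g \<noteq> g'" for g g' x x' r'
      proof -
        obtain i where "g i \<noteq> g' i" using ne by blast
        then have "s i - w i < \<bar>x $ i - x' $ i\<bar>" using x sw by (intro grid_box_separated) auto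
        also have "\<dots> \<le> norm (x - x')" using component_le_norm_cart[of "x - x'" i] by simp
        finally have "1 / (2 * real k) < norm (x - x')" using sw by simp
        then have "c * (1 / (2 * real k)) < c * norm (x - x')" using c(1) by (rule mult_strict_left_mono)
        also have "\<dots> \<le> \<nu> (x - x')" by (rule c(2))
        finally show ?thesis using r' unfolding h_def by simp
      qed
    qed (auto simp: sets_grid_box)
    also have "(\<Prod>i\<in>(UNIV::'d set). w i) = (1 / 2) ^ ?d * real k powr (- real ?d)"
      unfolding w_def using k by (simp add: powr_minus powr_realpow power_divide power_mult_distrib field_simps)
    also have "h powr \<alpha> = (c / 2) powr \<alpha> * real k powr (- \<alpha>)"
      unfolding h_def using c k by (simp add: powr_divide powr_mult powr_minus field_simps)
    also have "rate * real (card {()}) * ((1 / 2) ^ ?d * real k powr (- real ?d)) *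
        (\<kappa> * ((c / 2) powr \<alpha> * real k powr (- \<alpha>))) = A * (real k powr (- real ?d) * real k powr (- \<alpha>))"
      unfolding A_def by (simp add: mult_ac)
    also have "real k powr (- real ?d) * real k powr (- \<alpha>) = real k powr (- (real ?d + \<alpha>))"
      by (simp flip: powr_add)
    finally show "exp (- rate) * (A * real k powr (- (real ?d + \<alpha>))) ^ n
        \<le> prob {\<omega> \<in> space M. n \<le> cover_number \<nu> \<xi> R N \<omega>}" .
  qed
  then show ?thesis by (simp add: add_divide_distrib)
qed

text \<open>Balls with radii of constant order whose tips \<open>x + r *\<^sub>R axis i0 1\<close> are almost at the same
  height. Only \<open>x $ i0 + r\<close> has to be adjusted up to \<open>\<eta>\<close>, so the pairs of the height \<open>x $ i0\<close> and
  the radius fill a strip of width \<open>\<eta>\<close>, which is cut into about \<open>b / (2 * \<eta>)\<close> rectangles with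
  labels \<open>j\<close>. The remaining coordinates of the centres lie in different cells of a grid of
  dimension \<open>CARD('d) - 1\<close>. The last assumption says that this keeps the tips out of the other
  balls: there \<open>z\<close> is the vector from the centre of a ball to the tip of another one, and \<open>r\<close> is
  the radius of the former ball.\<close>

lemma prob_le_cover_number_ge_tips:
  fixes i0 :: 'd
  assumes norm: "is_norm \<nu>" and axis: "\<nu> (axis i0 1) = 1"
    and b: "0 < b" "b \<le> 1 / 2" and \<kappa>: "0 \<le> \<kappa>"
    and R: "\<And>s t. b / 2 \<le> s \<Longrightarrow> s \<le> t \<Longrightarrow> t \<le> b \<Longrightarrow>
      \<kappa> * (t - s) \<le> prob {\<omega> \<in> space M. R 1 \<omega> \<in> {s..t}}"
    and \<eta>: "0 < \<eta>" "\<eta> \<le> b / 4" and k: "1 \<le> k" and n: "1 \<le> n" "n \<le> k ^ (CARD('d) - 1)"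
    and H: "\<And>z r i. b / 2 \<le> r \<Longrightarrow> r \<le> b \<Longrightarrow> r - 2 * \<eta> \<le> z $ i0 \<Longrightarrow> i \<noteq> i0 \<Longrightarrow>
      1 / (2 * real k) < \<bar>z $ i\<bar> \<Longrightarrow> r < \<nu> z"
  shows "exp (- rate) * (rate * (b / 4) * \<kappa> * (1 / (2 * real k)) ^ (CARD('d) - 1) * \<eta>) ^ n
    \<le> prob {\<omega> \<in> space M. n \<le> cover_number \<nu> \<xi> R N \<omega>}"
proof -
  define m where "m = nat \<lfloor>b / (2 * \<eta>)\<rfloor>"
  have m: "b / 4 \<le> real m * \<eta>" "real m * \<eta> \<le> b / 2"
  proof -
    have "2 \<le> b / (2 * \<eta>)" using \<eta> by (simp add: pos_le_divide_eq)
    moreover have "y / 2 \<le> real (nat \<lfloor>y\<rfloor>) \<and> real (nat \<lfloor>y\<rfloor>) \<le> y" if "2 \<le> y" for y :: real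
      using that by (intro conjI; linarith)
    ultimately have "b / (2 * \<eta>) / 2 \<le> real m \<and> real m \<le> b / (2 * \<eta>)" unfolding m_def by blast
    then show "b / 4 \<le> real m * \<eta>" "real m * \<eta> \<le> b / 2" using \<eta>(1) by (auto simp: field_simps)
  qed
  define s where "s i = (if i = i0 then \<eta> else 1 / real k)" for i
  define w where "w i = (if i = i0 then \<eta> else 1 / (2 * real k))" for i
  \<comment> \<open>The cell labels leave the coordinate \<open>i0\<close> blank, \<open>D\<close> fills in the label \<open>j\<close> of the rectangle.\<close>
  define G where "G = (\<Pi>\<^sub>E i\<in>UNIV. if i = i0 then {0} else {..<k} :: nat set)"
  define D where "D g j = grid_box s w (g(i0 := j))" for g and j :: nat
  define T where "T j = {b - (real j + 1) * \<eta>..b - real j * \<eta>}" for j :: nat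
  have sw: "0 < s i" "0 < w i" "w i \<le> s i" for i
    unfolding s_def w_def using k \<eta> by (auto simp: field_simps)
  have w_prod: "(\<Prod>i\<in>UNIV. w i) = \<eta> * (1 / (2 * real k)) ^ (CARD('d) - 1)"
  proof -
    have "(\<Prod>i\<in>UNIV. w i) = w i0 * (\<Prod>i\<in>UNIV - {i0}. w i)" by (rule prod.remove) auto
    also have "(\<Prod>i\<in>UNIV - {i0}. w i) = (\<Prod>i\<in>UNIV - {i0}. 1 / (2 * real k))"
      by (intro prod.cong) (auto simp: w_def)
    finally show ?thesis by (simp add: w_def card_Diff_singleton)
  qed
  have G_mem: "g i0 = 0" "i \<noteq> i0 \<Longrightarrow> g i < k" if "g \<in> G" for g i
    using PiE_mem[of g UNIV "\<lambda>i. if i = i0 then {0} else {..<k}"] that unfolding G_def by (force split: if_splits)+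
  have card_G: "card G = k ^ (CARD('d) - 1)"
  proof -
    have "card G = (\<Prod>i\<in>UNIV. card (if i = i0 then {0} else {..<k} :: nat set))"
      unfolding G_def by (rule card_PiE) simp
    also have "\<dots> = (\<Prod>i\<in>UNIV - {i0}. card (if i = i0 then {0} else {..<k} :: nat set))"
      by (subst prod.remove[of _ i0]) auto
    also have "\<dots> = (\<Prod>i\<in>UNIV - {i0}. k)" by (intro prod.cong) auto
    finally show ?thesis by (simp add: card_Diff_singleton)
  qed
  have fit: "real ((g(i0 := j)) i + 1) * s i \<le> 1" if "g \<in> G" "j < m" for g j i
  proof (cases "i = i0")
    case True
    have "real (j + 1) * \<eta> \<le> real m * \<eta>" using that(2) \<eta> by (intro mult_right_mono) auto
    then show ?thesis using True m b by (simp add: s_def)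
  next
    case False
    then have "g i + 1 \<le> k" using G_mem(2)[OF that(1), of i] by simp
    then show ?thesis using False k by (simp add: s_def divide_le_eq)
  qed
  have T: "b / 2 \<le> r" "r \<le> b" if "r \<in> T j" "j < m" for r j
  proof -
    have "(real j + 1) * \<eta> \<le> real m * \<eta>" using that(2) \<eta> by (intro mult_right_mono) auto
    then show "b / 2 \<le> r" using that(1) m unfolding T_def by simp
    have "0 \<le> real j * \<eta>" using \<eta> by simp
    then show "r \<le> b" using that(1) unfolding T_def by simp
  qed
  have height: "b - \<eta> < x $ i0 + r" "x $ i0 + r < b + \<eta>" "0 < x $ i0" if "x \<in> D g j" "r \<in> T j" for x r g j
  proof -
    have "real j * \<eta> < x $ i0" "x $ i0 < real j * \<eta> + \<eta>"
      using that(1) unfolding D_def mem_grid_box by (auto simp: s_def w_def dest!: spec[of _ i0])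
    moreover have "0 \<le> real j * \<eta>" using \<eta> by simp
    moreover have "b - (real j * \<eta> + \<eta>) \<le> r" "r \<le> b - real j * \<eta>"
      using that(2) unfolding T_def by (auto simp: distrib_right)
    ultimately show "b - \<eta> < x $ i0 + r" "x $ i0 + r < b + \<eta>" "0 < x $ i0" by linarith+
  qed
  have "exp (- rate) * (rate * (b / 4) * \<kappa> * (1 / (2 * real k)) ^ (CARD('d) - 1) * \<eta>) ^ n =
      exp (- rate) * ((b / 4) * (rate * (\<Prod>i\<in>UNIV. w i) * \<kappa>)) ^ n"
    unfolding w_prod by (simp add: mult_ac)
  also have "\<dots> \<le> exp (- rate) * ((real m * \<eta>) * (rate * (\<Prod>i\<in>UNIV. w i) * \<kappa>)) ^ n"
    using m(1) b rate_pos sw \<kappa>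
    by (intro mult_left_mono power_mono mult_right_mono mult_nonneg_nonneg prod_nonneg)
      (auto intro: less_imp_le)
  also have "\<dots> = exp (- rate) * (rate * real (card {..<m}) * (\<Prod>i\<in>UNIV. w i) * (\<kappa> * \<eta>)) ^ n"
    by (simp add: mult_ac)
  also have "\<dots> \<le> prob {\<omega> \<in> space M. n \<le> cover_number \<nu> \<xi> R N \<omega>}"
  proof (rule prob_le_cover_number_ge[OF norm n(1), where G = G and D = D and T = T
        and tip = "\<lambda>x r. x + r *\<^sub>R axis i0 1"])
    show "finite G" unfolding G_def by (intro finite_PiE) auto
    show "n \<le> card G" unfolding card_G by (rule n)
    show "D g j \<inter> D g' j' = {}" if "g \<in> G" "g' \<in> G" "(g, j) \<noteq> (g', j')" for g j g' j'
    proof -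
      have "g(i0 := j) \<noteq> g'(i0 := j')"
        using that G_mem(1)[of g] G_mem(1)[of g'] by (metis fun_upd_same fun_upd_triv fun_upd_upd)
      then show ?thesis unfolding D_def using sw by (intro grid_box_disjoint) auto
    qed
    show "0 \<le> (\<Prod>i\<in>UNIV. w i)" using sw by (intro prod_nonneg) (auto intro: less_imp_le)
    show "(\<Prod>i\<in>UNIV. w i) \<le> prob {\<omega> \<in> space M. \<xi> 1 \<omega> \<in> D g j}" if "g \<in> G" "j \<in> {..<m}" for g j
      using prob_grid_box[of w s "g(i0 := j)"] sw fit[of g j] that unfolding D_def by simp
    show "0 \<le> \<kappa> * \<eta>" using \<kappa> \<eta> by simp
    show "\<kappa> * \<eta> \<le> prob {\<omega> \<in> space M. R 1 \<omega> \<in> T j}" if "j \<in> {..<m}" for j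
    proof -
      have ends: "b - (real j + 1) * \<eta> \<in> T j" "b - real j * \<eta> \<in> T j"
        unfolding T_def using \<eta> by (auto simp: algebra_simps)
      have "\<kappa> * ((b - real j * \<eta>) - (b - (real j + 1) * \<eta>)) \<le> prob {\<omega> \<in> space M. R 1 \<omega> \<in> T j}"
        unfolding T_def
      proof (rule R)
        show "b / 2 \<le> b - (real j + 1) * \<eta>" using T(1)[OF ends(1)] that by simp
        show "b - real j * \<eta> \<le> b" using T(2)[OF ends(2)] that by simp
        show "b - (real j + 1) * \<eta> \<le> b - real j * \<eta>" using \<eta> by (simp add: algebra_simps)
      qed
      then show ?thesis by (simp add: algebra_simps)
    qed
    show "x + r *\<^sub>R axis i0 1 \<in> unit_cube \<and> \<nu> (x + r *\<^sub>R axis i0 1 - x) \<le> r"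
      if "g \<in> G" "j \<in> {..<m}" "x \<in> D g j" "r \<in> T j" for g j x r
    proof
      have r: "b / 2 \<le> r" "r \<le> b" using T[OF that(4)] that(2) by auto
      have x: "x \<in> unit_cube"
        using grid_box_subset_unit_cube[of s w "g(i0 := j)"] sw fit[of g j] that unfolding D_def by auto
      have "0 \<le> (x + r *\<^sub>R axis i0 1) $ i \<and> (x + r *\<^sub>R axis i0 1) $ i \<le> 1" for i
      proof (cases "i = i0")
        case True
        then show ?thesis using height[OF that(3,4)] r b \<eta> by simp
      next
        case False
        then show ?thesis using x by (simp add: axis_def mem_box_cart)
      qed
      then show "x + r *\<^sub>R axis i0 1 \<in> unit_cube" by (simp add: mem_box_cart)
      have "\<nu> (r *\<^sub>R axis i0 1) = \<bar>r\<bar> * \<nu> (axis i0 1)" using norm unfolding is_norm_def by blast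
      then show "\<nu> (x + r *\<^sub>R axis i0 1 - x) \<le> r" using axis r b by simp
    qed
    show "r' < \<nu> (x + r *\<^sub>R axis i0 1 - x')"
      if "g \<in> G" "j \<in> {..<m}" "x \<in> D g j" "r \<in> T j" "g' \<in> G" "j' \<in> {..<m}" "x' \<in> D g' j'" "r' \<in> T j'"
        and ne: "g \<noteq> g'" for g j x r g' j' x' r'
    proof -
      obtain i where i: "g i \<noteq> g' i" using ne by blast
      then have i0: "i \<noteq> i0" using G_mem(1) that(1,5) by metis
      have "s i - w i < \<bar>x $ i - x' $ i\<bar>"
        using that(3,7) sw i i0 unfolding D_def
        by (intro grid_box_separated[of x s w "g(i0 := j)" x' "g'(i0 := j')"]) auto
      moreover have "s i - w i = 1 / (2 * real k)" using i0 k by (simp add: s_def w_def field_simps)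
      moreover have "(x + r *\<^sub>R axis i0 1 - x') $ i = x $ i - x' $ i" using i0 by (simp add: axis_def)
      ultimately have "1 / (2 * real k) < \<bar>(x + r *\<^sub>R axis i0 1 - x') $ i\<bar>" by metis
      moreover have "r' - 2 * \<eta> \<le> (x + r *\<^sub>R axis i0 1 - x') $ i0"
        using height[OF that(3,4)] height[OF that(7,8)] by simp
      ultimately show ?thesis using T[OF that(8)] that(6) i0 by (intro H[of r' _ i]) auto
    qed
  qed (auto simp: D_def T_def sets_grid_box)
  finally show ?thesis .
qed

text \<open>If the tolerance \<open>\<eta>\<close> for the height of the tips may be chosen of order \<open>k ^ (- \<gamma>)\<close>, then the
  exponent \<open>1 + \<gamma> / (CARD('d) - 1)\<close> results.\<close>

lemma ge_exp_nlogn_tips: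
  fixes i0 :: 'd and \<gamma> :: nat
  assumes dim: "2 \<le> CARD('d)" and norm: "is_norm \<nu>" and axis: "\<nu> (axis i0 1) = 1"
    and b: "0 < b" "b \<le> 1 / 2" and \<kappa>: "0 < \<kappa>" and e: "0 < e" and \<gamma>: "1 \<le> \<gamma>"
    and R: "\<And>s t. b / 2 \<le> s \<Longrightarrow> s \<le> t \<Longrightarrow> t \<le> b \<Longrightarrow>
      \<kappa> * (t - s) \<le> prob {\<omega> \<in> space M. R 1 \<omega> \<in> {s..t}}"
    and H: "\<And>k z r i. 1 \<le> k \<Longrightarrow> e / real k ^ \<gamma> \<le> b / 4 \<Longrightarrow> b / 2 \<le> r \<Longrightarrow> r \<le> b \<Longrightarrow>
      r - 2 * (e / real k ^ \<gamma>) \<le> z $ i0 \<Longrightarrow> i \<noteq> i0 \<Longrightarrow> 1 / (2 * real k) < \<bar>z $ i\<bar> \<Longrightarrow> r < \<nu> z"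
  shows "ge_exp_nlogn (\<lambda>n. prob {\<omega> \<in> space M. n \<le> cover_number \<nu> \<xi> R N \<omega>})
    (1 + real \<gamma> / (real CARD('d) - 1))"
proof -
  define m where "m = CARD('d) - 1"
  have m: "0 < m" "real m = real CARD('d) - 1" using dim unfolding m_def by auto
  define A where "A = rate * (b / 4) * \<kappa> * (1 / 2) ^ m * e"
  have "ge_exp_nlogn (\<lambda>n. prob {\<omega> \<in> space M. n \<le> cover_number \<nu> \<xi> R N \<omega>}) ((real m + real \<gamma>) / real m)"
  proof (rule ge_exp_nlogn_of_grid)
    show "0 < exp (- rate)" "0 < A" "0 < real m + real \<gamma>" "0 < m"
      unfolding A_def using rate_pos \<kappa> b e m by auto
    fix k n :: nat
    assume k0: "nat \<lceil>4 * e / b\<rceil> \<le> k" and k: "1 \<le> k" and n: "1 \<le> n" "n \<le> k ^ m"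
    have \<eta>: "e / real k ^ \<gamma> \<le> b / 4"
    proof -
      have "4 * e / b \<le> real k" using k0 by linarith
      also have "\<dots> \<le> real k ^ \<gamma>" using k \<gamma> by (intro self_le_power) auto
      finally show ?thesis using b k by (simp add: divide_le_eq mult_ac)
    qed
    have "exp (- rate) * (rate * (b / 4) * \<kappa> * (1 / (2 * real k)) ^ (CARD('d) - 1) * (e / real k ^ \<gamma>)) ^ n
        \<le> prob {\<omega> \<in> space M. n \<le> cover_number \<nu> \<xi> R N \<omega>}"
    proof (rule prob_le_cover_number_ge_tips[OF norm axis b less_imp_le[OF \<kappa>] _ _ \<eta> k n(1)])
      show "0 < e / real k ^ \<gamma>" using e k by simp
      show "n \<le> k ^ (CARD('d) - 1)" using n by (simp add: m_def)
      show "\<kappa> * (t - s) \<le> prob {\<omega> \<in> space M. R 1 \<omega> \<in> {s..t}}"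
        if "b / 2 \<le> s" "s \<le> t" "t \<le> b" for s t
        using that by (rule R)
      show "r < \<nu> z" if "b / 2 \<le> r" "r \<le> b" "r - 2 * (e / real k ^ \<gamma>) \<le> z $ i0" "i \<noteq> i0"
        "1 / (2 * real k) < \<bar>z $ i\<bar>" for z r i
        using k \<eta> that by (rule H)
    qed
    also have "rate * (b / 4) * \<kappa> * (1 / (2 * real k)) ^ (CARD('d) - 1) * (e / real k ^ \<gamma>) =
        A * real k powr (- (real m + real \<gamma>))"
    proof -
      have "real k powr (- (real m + real \<gamma>)) = inverse (real k powr real (m + \<gamma>))"
        unfolding powr_minus of_nat_add ..
      also have "\<dots> = 1 / (real k ^ m * real k ^ \<gamma>)"
        using k by (subst powr_realpow) (auto simp: power_add divide_simps)
      finally show ?thesis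
        unfolding A_def m_def[symmetric] by (simp add: power_divide power_mult_distrib)
    qed
    finally show "exp (- rate) * (A * real k powr (- (real m + real \<gamma>))) ^ n
        \<le> prob {\<omega> \<in> space M. n \<le> cover_number \<nu> \<xi> R N \<omega>}" .
  qed
  moreover have "(real m + real \<gamma>) / real m = 1 + real \<gamma> / (real CARD('d) - 1)"
    using m by (simp add: add_divide_distrib flip: m(2))
  ultimately show ?thesis by simp
qed

text \<open>Cubes of side length \<open>1 / k\<close> have diameter of order \<open>1 / k\<close> in every norm. Rounding down the
  coordinates gives \<open>k + 1\<close> cells per side, as the upper faces of the cube form cells of their
  own.\<close>

lemma le_exp_nlogn_cover_number:
  assumes norm: "is_norm \<nu>" and U: "0 < U"
    and R: "\<And>s t. s \<le> t \<Longrightarrow> prob {\<omega> \<in> space M. R 1 \<omega> \<in> {s..t}} \<le> U * (t - s)"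
  shows "le_exp_nlogn (\<lambda>n. prob {\<omega> \<in> space M. n \<le> cover_number \<nu> \<xi> R N \<omega>}) (1 + 1 / real CARD('d))"
proof -
  obtain B where B: "0 < B" "\<And>x. \<nu> x \<le> B * norm x" using is_norm_le[OF norm] by blast
  let ?d = "CARD('d)"
  show ?thesis
  proof (rule le_exp_nlogn_of_grid[OF rate_pos])
    show "0 < U * (3 * (B * real ?d))" using U B by simp
    show "0 < ?d" by simp
    fix k n :: nat
    assume n: "2 \<le> n" and k: "1 \<le> k" "U * (3 * (B * real ?d)) \<le> real k"
    define cell where "cell x i = \<lfloor>real k * x $ i\<rfloor>" for x :: "real ^ 'd" and i
    define C where "C = (UNIV \<rightarrow>\<^sub>E {0..int k} :: ('d \<Rightarrow> int) set)"
    have card_C: "card C = (k + 1) ^ ?d"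
      unfolding C_def by (subst card_funcsetE) (auto simp: nat_add_distrib)
    have "prob {\<omega> \<in> space M. n \<le> cover_number \<nu> \<xi> R N \<omega>} \<le>
        rate ^ n / fact n * (U * (3 * (B * (real ?d / real k)))) ^ (n - card C)"
    proof (rule prob_le_cover_number_le[OF norm n, where cell = cell])
      show "finite C" unfolding C_def by (intro finite_PiE) auto
      show "cell -` {c} \<in> sets borel" for c
      proof -
        have "cell -` {c} = {x \<in> space borel. \<forall>i\<in>UNIV. \<lfloor>real k * x $ i\<rfloor> = c i}"
          unfolding cell_def by (auto simp: fun_eq_iff)
        also have "\<dots> \<in> sets borel" by measurable
        finally show ?thesis .
      qed
      show "cell x \<in> C" if "x \<in> unit_cube" for x
      proof -
        have "0 \<le> \<lfloor>real k * x $ i\<rfloor> \<and> \<lfloor>real k * x $ i\<rfloor> \<le> int k" for i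
        proof -
          have x: "0 \<le> x $ i" "x $ i \<le> 1" using that by (auto simp: mem_box_cart)
          then have "real k * x $ i \<le> real k * 1" by (intro mult_left_mono) auto
          then show ?thesis using x by (auto simp: floor_le_iff)
        qed
        then show ?thesis unfolding C_def cell_def by auto
      qed
      show "\<nu> (x - y) \<le> B * (real ?d / real k)" if "cell x = cell y" for x y
      proof -
        have "\<bar>(x - y) $ i\<bar> \<le> 1 / real k" for i
        proof -
          have "\<lfloor>real k * x $ i\<rfloor> = \<lfloor>real k * y $ i\<rfloor>" using that unfolding cell_def by (rule fun_cong)
          then have "\<bar>real k * x $ i - real k * y $ i\<bar> \<le> 1" by linarith
          then have "real k * \<bar>x $ i - y $ i\<bar> \<le> 1"
            by (simp add: abs_mult flip: right_diff_distrib)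
          then show ?thesis using k by (simp add: field_simps)
        qed
        then have "(\<Sum>i\<in>UNIV. \<bar>(x - y) $ i\<bar>) \<le> (\<Sum>i\<in>(UNIV::'d set). 1 / real k)" by (rule sum_mono)
        then have "norm (x - y) \<le> real ?d / real k" using norm_le_l1_cart[of "x - y"] by simp
        then have "B * norm (x - y) \<le> B * (real ?d / real k)" using B(1) by (intro mult_left_mono) auto
        then show ?thesis using B(2)[of "x - y"] by linarith
      qed
      show "0 < B * (real ?d / real k)" using B k by simp
      show "0 \<le> U * (3 * (B * (real ?d / real k)))" using U B by simp
      show "U * (3 * (B * (real ?d / real k))) \<le> 1" using k by (simp add: divide_le_eq)
      show "prob {\<omega> \<in> space M. R 1 \<omega> \<in> {a..a + 3 * (B * (real ?d / real k))}}
          \<le> U * (3 * (B * (real ?d / real k)))" for a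
        using R[of a "a + 3 * (B * (real ?d / real k))"] B by simp
    qed
    then show "prob {\<omega> \<in> space M. n \<le> cover_number \<nu> \<xi> R N \<omega>} \<le>
        rate ^ n / fact n * (U * (3 * (B * real ?d)) / real k) ^ (n - (k + 1) ^ ?d)"
      unfolding card_C by simp
  qed
qed

end

text \<open>The loss of \<open>2 * \<eta>\<close> in height, with \<open>\<eta> = 1 / (4 * k)\<close>, is made up for by the distance in
  coordinate \<open>i\<close>, since coordinates add up in the \<open>l1\<close> norm.\<close>

lemma l1_norm_tip_outside:
  fixes z :: "real ^ 'd"
  assumes "1 \<le> k" "r - 2 * (1 / 4 / real k) \<le> z $ i0" "i \<noteq> i0" "1 / (2 * real k) < \<bar>z $ i\<bar>"
  shows "r < l1_norm z"
proof -
  have "2 * (1 / 4 / real k) = 1 / (2 * real k)" by simp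
  then have "r < z $ i0 + \<bar>z $ i\<bar>" using assms(2,4) by linarith
  also have "\<dots> \<le> (\<Sum>j\<in>{i0, i}. \<bar>z $ j\<bar>)" using assms(3) by simp
  also have "\<dots> \<le> l1_norm z" unfolding l1_norm_def by (intro sum_mono2) auto
  finally show ?thesis .
qed

text \<open>The Euclidean norm adds up the squares of the coordinates. For \<open>r \<le> 1\<close>, the loss of \<open>2 * \<eta>\<close> in
  height lowers the square by at most \<open>4 * \<eta>\<close>, while the distance in coordinate \<open>i\<close> contributes only the square
  of the mesh, and \<open>\<eta> = 1 / (16 * k\<^sup>2)\<close> balances the two.\<close>

lemma norm_tip_outside:
  fixes z :: "real ^ 'd"
  assumes k: "1 \<le> k" and r: "2 * (1 / 16 / real k ^ 2) \<le> r" "r \<le> 1"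
    and z: "r - 2 * (1 / 16 / real k ^ 2) \<le> z $ i0" "i \<noteq> i0" "1 / (2 * real k) < \<bar>z $ i\<bar>"
  shows "r < norm z"
proof (rule power2_less_imp_less)
  define \<eta> where "\<eta> = 1 / 16 / real k ^ 2"
  have \<eta>: "0 < \<eta>" unfolding \<eta>_def using k by simp
  have i: "4 * \<eta> < (z $ i)\<^sup>2"
  proof -
    have "4 * \<eta> = (1 / (2 * real k))\<^sup>2" unfolding \<eta>_def by (simp add: power2_eq_square)
    also have "\<dots> < \<bar>z $ i\<bar>\<^sup>2" using z(3) k by (intro power_strict_mono) auto
    finally show ?thesis by simp
  qed
  have "(r - 2 * \<eta>)\<^sup>2 \<le> (z $ i0)\<^sup>2" using r z(1) unfolding \<eta>_def by (intro power_mono) auto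
  moreover have "(r - 2 * \<eta>)\<^sup>2 \<ge> r\<^sup>2 - 4 * \<eta>"
  proof -
    have "r * \<eta> \<le> 1 * \<eta>" using r(2) \<eta> by (intro mult_right_mono) auto
    moreover have "(r - 2 * \<eta>)\<^sup>2 = r\<^sup>2 - 4 * (r * \<eta>) + (2 * \<eta>)\<^sup>2"
      by (simp add: power2_eq_square algebra_simps)
    ultimately show ?thesis using zero_le_power2[of "2 * \<eta>"] by linarith
  qed
  ultimately have "r\<^sup>2 < (z $ i0)\<^sup>2 + (z $ i)\<^sup>2" using i by linarith
  also have "\<dots> = (\<Sum>j\<in>{i0, i}. (z $ j)\<^sup>2)" using z(2) by simp
  also have "\<dots> \<le> (\<Sum>j\<in>UNIV. (z $ j)\<^sup>2)" by (intro sum_mono2) auto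
  also have "\<dots> = (norm z)\<^sup>2" by (simp add: norm_vec_def L2_set_def sum_nonneg)
  finally show "r\<^sup>2 < (norm z)\<^sup>2" .
qed simp

theorem theorem3:
  fixes M :: "'w measure"
    and \<nu> :: "real ^ 'd \<Rightarrow> real"
    and \<xi> :: "nat \<Rightarrow> 'w \<Rightarrow> real ^ 'd"
    and R :: "nat \<Rightarrow> 'w \<Rightarrow> real"
    and N :: "'w \<Rightarrow> nat"
    and p :: "real \<Rightarrow> real"
    and rate \<alpha> :: real
  assumes dim_ge_2: "2 \<le> CARD('d)"
    and nu_norm: "is_norm \<nu>"
    and model: "random_balls M \<xi> R N rate"
    and p_nonneg: "\<And>z. 0 < z \<Longrightarrow> 0 \<le> p z"
    and density: "distributed M lborel (R 1) (\<lambda>z. ennreal (indicator {0<..} z * p z))"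
    and alpha_pos: "0 < \<alpha>"
    and p_near_0: "comparable_at_0 p (\<lambda>z. z powr (\<alpha> - 1))"
    and p_bounded: "bounded (p ` {0<..})"
  defines "P \<equiv> \<lambda>n. measure M {\<omega> \<in> space M. n \<le> cover_number \<nu> \<xi> R N \<omega>}"
  shows "ge_exp_nlogn P (1 + \<alpha> / real CARD('d))
    \<and> le_exp_nlogn P (1 + min \<alpha> 1 / real CARD('d))
    \<and> (\<nu> = l1_norm \<longrightarrow> ge_exp_nlogn P (1 + 1 / (real CARD('d) - 1)))
    \<and> (\<nu> = norm \<longrightarrow> ge_exp_nlogn P (1 + 2 / (real CARD('d) - 1)))"
proof -
  interpret random_balls M \<xi> R N rate by (rule model)
  have \<alpha>: "1 \<le> \<alpha>" using exponent_ge_1_if_bounded[OF p_near_0 p_bounded] .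
  obtain c z0 where c: "0 < c" and z0: "0 < z0"
    and p_ge: "\<And>z. 0 < z \<Longrightarrow> z < z0 \<Longrightarrow> c * z powr (\<alpha> - 1) \<le> p z"
  proof -
    obtain c C where c: "0 < c" "\<forall>\<^sub>F z in at_right 0. c \<le> p z / z powr (\<alpha> - 1) \<and> p z / z powr (\<alpha> - 1) \<le> C"
      using p_near_0 unfolding comparable_at_0_def by blast
    then obtain z0 where z0: "0 < z0" "\<And>z. 0 < z \<Longrightarrow> z < z0 \<Longrightarrow> c \<le> p z / z powr (\<alpha> - 1)"
      unfolding eventually_at_right_field by blast
    have "c * z powr (\<alpha> - 1) \<le> p z" if "0 < z" "z < z0" for z
      using z0(2)[OF that] that by (simp add: pos_le_divide_eq)
    with c(1) z0(1) show thesis by (rule that)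
  qed
  have R_ge: "c * s powr (\<alpha> - 1) * (t - s) \<le> prob {\<omega> \<in> space M. R 1 \<omega> \<in> {s..t}}"
    if "0 < s" "s \<le> t" "t < z0" for s t
  proof (rule measure_interval_of_density(2)[OF prob_space_axioms density])
    show "c * s powr (\<alpha> - 1) \<le> p z" if z: "s \<le> z" "z \<le> t" for z
    proof -
      have "c * s powr (\<alpha> - 1) \<le> c * z powr (\<alpha> - 1)"
        using c \<alpha> z \<open>0 < s\<close> by (intro mult_left_mono powr_mono2) auto
      also have "\<dots> \<le> p z" using z \<open>0 < s\<close> \<open>t < z0\<close> by (intro p_ge) auto
      finally show ?thesis .
    qed
  qed (use that c in auto)
  obtain U where U: "0 < U" "\<And>z. 0 < z \<Longrightarrow> p z \<le> U"
  proof -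
    obtain B where B: "0 < B" "\<forall>y\<in>p ` {0<..}. norm y \<le> B"
      using p_bounded unfolding bounded_pos by blast
    then have "p z \<le> B" if "0 < z" for z using that by (auto simp: abs_le_iff)
    with B(1) show thesis by (rule that)
  qed
  have R_le: "prob {\<omega> \<in> space M. R 1 \<omega> \<in> {s..t}} \<le> U * (t - s)" if "s \<le> t" for s t
    using measure_interval_of_density(1)[OF prob_space_axioms density U(2)] U(1) that by simp
  define b where "b = min (1 / 2) (z0 / 2)"
  have b: "0 < b" "b \<le> 1 / 2" "b < z0" unfolding b_def using z0 by auto
  define \<kappa> where "\<kappa> = c * (b / 2) powr (\<alpha> - 1)"
  have \<kappa>: "0 < \<kappa>" unfolding \<kappa>_def using c b by simp
  have R_tips: "\<kappa> * (t - s) \<le> prob {\<omega> \<in> space M. R 1 \<omega> \<in> {s..t}}" if "b / 2 \<le> s" "s \<le> t" "t \<le> b" for s t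
  proof -
    have "\<kappa> * (t - s) \<le> c * s powr (\<alpha> - 1) * (t - s)"
      unfolding \<kappa>_def using c \<alpha> b that by (intro mult_right_mono mult_left_mono powr_mono2) auto
    also have "\<dots> \<le> prob {\<omega> \<in> space M. R 1 \<omega> \<in> {s..t}}" using that b by (intro R_ge) auto
    finally show ?thesis .
  qed
  obtain i0 :: 'd where True by blast
  have "ge_exp_nlogn P (1 + \<alpha> / real CARD('d))"
    unfolding P_def
  proof (rule ge_exp_nlogn_small_balls[OF nu_norm _ z0 alpha_pos])
    show "0 < c * (1 / 2) powr \<alpha>" using c by simp
    show "c * (1 / 2) powr \<alpha> * h powr \<alpha> \<le> prob {\<omega> \<in> space M. R 1 \<omega> \<in> {h / 2..h}}"
      if h: "0 < h" "h < z0" for h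
    proof -
      have "c * (1 / 2) powr \<alpha> * h powr \<alpha> = c * (h / 2) powr \<alpha>"
        using h by (simp add: powr_divide)
      also have "\<dots> = c * (h / 2) powr (\<alpha> - 1) * (h - h / 2)"
        using h by (simp add: powr_diff)
      also have "\<dots> \<le> prob {\<omega> \<in> space M. R 1 \<omega> \<in> {h / 2..h}}" using h by (intro R_ge) auto
      finally show ?thesis .
    qed
  qed
  moreover have "le_exp_nlogn P (1 + min \<alpha> 1 / real CARD('d))"
    using le_exp_nlogn_cover_number[OF nu_norm U(1) R_le] \<alpha> unfolding P_def by simp
  moreover have "ge_exp_nlogn P (1 + 1 / (real CARD('d) - 1))" if l1: "\<nu> = l1_norm"
  proof -
    have "\<nu> (axis i0 1) = 1" unfolding l1 l1_norm_def by (simp add: axis_def if_distrib cong: if_cong)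
    from ge_exp_nlogn_tips[OF dim_ge_2 nu_norm this b(1,2) \<kappa>, of "1 / 4" 1] R_tips
    show ?thesis
      unfolding P_def l1 by (simp add: l1_norm_tip_outside)
  qed
  moreover have "ge_exp_nlogn P (1 + 2 / (real CARD('d) - 1))" if l2: "\<nu> = norm"
  proof -
    have "\<nu> (axis i0 1) = 1" unfolding l2 by simp
    then have "ge_exp_nlogn P (1 + real 2 / (real CARD('d) - 1))"
      unfolding P_def
    proof (rule ge_exp_nlogn_tips[OF dim_ge_2 nu_norm _ b(1,2) \<kappa>, of _ "1 / 16"])
      fix k z r i
      assume "1 \<le> k" "1 / 16 / real k ^ 2 \<le> b / 4" "b / 2 \<le> r" "r \<le> b"
        "r - 2 * (1 / 16 / real k ^ 2) \<le> z $ i0" "i \<noteq> i0" "1 / (2 * real k) < \<bar>z $ i\<bar>"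
      then show "r < \<nu> z" unfolding l2 using b by (intro norm_tip_outside[of k r z i0 i]) linarith+
    qed (use R_tips in auto)
    then show ?thesis by simp
  qed
  ultimately show ?thesis by blast
qed

end
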